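(* Let $G\ne K_3$ be a connected, well-edge-dominated graph containing exactly one triangle $xyz$. Let $G'=G-N_e[xy]$ and let $G'_z$ be the component of $G'$ containing $z$. Then $G'_z$ is bipartite. Moreover, if $G'_z$ is nontrivial, then one of the following holds: (a) every edge incident to $x$ other than $xy$ and $xz$, and every edge incident to $y$ other than $xy$ and $yz$ (if such an edge exists), is incident to a vertex of $G'_z$; and moreover, if $\deg_G(x)=2$ or $\deg_G(y)=2$, then $z$ is detachable in $G'_z$; (b) every component of $G'$ other than $G'_z$ has a vertex adjacent to $x$ in $G$, $\deg_G(y)\ge 3$, and $z$ is detachable in $G'_z$.
   Context: All graphs are simple and finite. A set $F$ of edges of $G$ is an edge dominating set if every edge of $G$ is in $F$ or shares an endpoint with an edge of $F$. $G$ is well-edge-dominated if all minimal (with respect to inclusion) edge dominating sets of $G$ have the same cardinality. A triangle is a subgraph isomorphic to $K_3$. For a set $M$ of independent edges (e.g. a single edge), $G-N_e[M]$ denotes the graph obtained from $G$ by deleting all vertices incident with an edge of $M$ (and all edges incident to them). A graph is nontrivial if it has at least two vertices. For a well-edge-dominated connected bipartite graph $H$ with bipartition $V(H)=A\cup B$, $|A|<|B|$, a vertex $w\in B$ is detachable (in $H$) if $H-w$ is well-edge-dominated; saying $z$ is detachable in $H$ includes that $H$ is such a graph with $z$ in the larger part $B$.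
   Formalization: Alternative (b) is proved up to interchanging the names x and y; with the names fixed the statement fails for the graph with edges xy, xz, yz, zc, ca, ax, yp, pq. *)

theory Defs
  imports Main
begin

section \<open>Finite simple graphs\<close>

record 'a ugraph =
  verts :: "'a set"
  edges :: "'a set set"

definition simple_graph :: "'a ugraph \<Rightarrow> bool" where
  "simple_graph G \<longleftrightarrow> finite (verts G) \<and> (\<forall>e\<in>edges G. e \<subseteq> verts G \<and> card e = 2)"

definition degree :: "'a ugraph \<Rightarrow> 'a \<Rightarrow> nat" where
  "degree G v = card {e \<in> edges G. v \<in> e}"

definition nontrivial :: "'a ugraph \<Rightarrow> bool" where
  "nontrivial G \<longleftrightarrow> 2 \<le> card (verts G)"

definition subgraph :: "'a ugraph \<Rightarrow> 'a ugraph \<Rightarrow> bool" where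
  "subgraph H G \<longleftrightarrow> simple_graph H \<and> verts H \<subseteq> verts G \<and> edges H \<subseteq> edges G"

definition induced :: "'a ugraph \<Rightarrow> 'a set \<Rightarrow> 'a ugraph" where
  "induced G S = \<lparr>verts = verts G \<inter> S, edges = {e \<in> edges G. e \<subseteq> S}\<rparr>"

definition delete_verts :: "'a ugraph \<Rightarrow> 'a set \<Rightarrow> 'a ugraph" where
  "delete_verts G S = \<lparr>verts = verts G - S, edges = {e \<in> edges G. e \<inter> S = {}}\<rparr>"

definition complete_on :: "'a set \<Rightarrow> 'a ugraph" where
  "complete_on S = \<lparr>verts = S, edges = {e. e \<subseteq> S \<and> card e = 2}\<rparr>"

text \<open>\<open>is_complete n G\<close>: the graph \<open>G\<close> is isomorphic to the complete graph on \<open>n\<close> vertices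
  (for \<open>n \<ge> 1\<close>, as \<open>card\<close> is \<open>0\<close> on infinite sets).\<close>

definition is_complete :: "nat \<Rightarrow> 'a ugraph \<Rightarrow> bool" where
  "is_complete n G \<longleftrightarrow> card (verts G) = n \<and> G = complete_on (verts G)"

definition triangles :: "'a ugraph \<Rightarrow> 'a ugraph set" where
  "triangles G = {T. subgraph T G \<and> is_complete 3 T}"

definition adj_rel :: "'a ugraph \<Rightarrow> ('a \<times> 'a) set" where
  "adj_rel G = {(u, v). {u, v} \<in> edges G}"

definition connected_graph :: "'a ugraph \<Rightarrow> bool" where
  "connected_graph G \<longleftrightarrow>
     verts G \<noteq> {} \<and> (\<forall>u\<in>verts G. \<forall>v\<in>verts G. (u, v) \<in> (adj_rel G)\<^sup>*)"

definition component_of :: "'a ugraph \<Rightarrow> 'a \<Rightarrow> 'a ugraph" where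
  "component_of G v = induced G {u \<in> verts G. (v, u) \<in> (adj_rel G)\<^sup>*}"

definition components :: "'a ugraph \<Rightarrow> 'a ugraph set" where
  "components G = component_of G ` verts G"

definition bipartition :: "'a ugraph \<Rightarrow> 'a set \<Rightarrow> 'a set \<Rightarrow> bool" where
  "bipartition G A B \<longleftrightarrow>
     A \<union> B = verts G \<and> A \<inter> B = {} \<and> (\<forall>e\<in>edges G. \<exists>a\<in>A. \<exists>b\<in>B. e = {a, b})"

definition bipartite :: "'a ugraph \<Rightarrow> bool" where
  "bipartite G \<longleftrightarrow> (\<exists>A B. bipartition G A B)"


section \<open>Well-edge-dominated graphs\<close>

definition edge_dominating :: "'a ugraph \<Rightarrow> 'a set set \<Rightarrow> bool" where
  "edge_dominating G F \<longleftrightarrow>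
     F \<subseteq> edges G \<and> (\<forall>e\<in>edges G. e \<in> F \<or> (\<exists>f\<in>F. e \<inter> f \<noteq> {}))"

definition minimal_edge_dominating :: "'a ugraph \<Rightarrow> 'a set set \<Rightarrow> bool" where
  "minimal_edge_dominating G F \<longleftrightarrow>
     edge_dominating G F \<and> (\<forall>F'. F' \<subset> F \<longrightarrow> \<not> edge_dominating G F')"

definition well_edge_dominated :: "'a ugraph \<Rightarrow> bool" where
  "well_edge_dominated G \<longleftrightarrow>
     (\<forall>F F'. minimal_edge_dominating G F \<and> minimal_edge_dominating G F' \<longrightarrow> card F = card F')"

text \<open>\<open>delete_nbhd G M\<close> is the graph $G - N_e[M]$ for a set \<open>M\<close> of independent edges.\<close>

definition delete_nbhd :: "'a ugraph \<Rightarrow> 'a set set \<Rightarrow> 'a ugraph" where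
  "delete_nbhd G M = delete_verts G (\<Union>M)"

text \<open>The sets \<open>A\<close>, \<open>B\<close> below are unique, because a connected graph has only one bipartition
  and \<open>B\<close> is its strictly larger part.\<close>

definition detachable :: "'a ugraph \<Rightarrow> 'a \<Rightarrow> bool" where
  "detachable H w \<longleftrightarrow>
     simple_graph H \<and> connected_graph H \<and> well_edge_dominated H \<and>
     (\<exists>A B. bipartition H A B \<and> card A < card B \<and> w \<in> B) \<and>
     well_edge_dominated (delete_verts H {w})"

end

theory Submission
  imports Defs
begin

text \<open>
  All maximal matchings of a well-edge-dominated graph have the same size, here called \<open>nu\<close>, and
  deleting the vertices of a matching \<open>K\<close> lowers \<open>nu\<close> by \<open>card K\<close>.

  Bipartiteness. Consider an odd cycle that avoids \<open>x\<close> and \<open>y\<close>. Since no outside vertex is adjacent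
  to two consecutive vertices of it, a count of matchings shows that its vertex set \<open>S\<close> is
  \<open>solid\<close>: for every maximal matching outside \<open>S\<close>, no unmatched vertex is adjacent to \<open>S\<close>. A shortest
  such cycle therefore has at most seven vertices, and every neighbour outside \<open>S\<close> of a vertex
  adjacent to \<open>S\<close> is itself adjacent to \<open>S\<close>, at prescribed positions. For length five or seven this
  contradicts the triangle at \<open>z\<close>, after lengthening the cycle by two through \<open>z\<close> and a further
  neighbour of \<open>z\<close> if necessary.

  Alternatives (a) and (b). If \<open>x\<close> has a neighbour \<open>c\<close> outside \<open>G'\<^sub>z\<close>, delete the matching
  \<open>{xc, yz}\<close> and compare with deleting \<open>xy\<close>: the value \<open>nu\<close> of \<open>G'\<^sub>z\<close> does not drop when \<open>z\<close> is
  removed. So some maximal matching of \<open>G'\<^sub>z\<close> misses \<open>z\<close>, and in a connected bipartite graph it then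
  saturates the part not containing \<open>z\<close>, which makes \<open>z\<close> detachable. Deleting \<open>{xc, yd}\<close>
  similarly shows that \<open>c\<close> and \<open>d\<close> cannot lie in different components of \<open>G'\<close>.
\<close>

section \<open>Matchings in well-edge-dominated graphs\<close>

definition edge_set :: "'a set set \<Rightarrow> bool" where
  "edge_set E \<longleftrightarrow> finite E \<and> (\<forall>e\<in>E. card e = 2)"

definition matching :: "'a set set \<Rightarrow> 'a set set \<Rightarrow> bool" where
  "matching E M \<longleftrightarrow> M \<subseteq> E \<and> (\<forall>e\<in>M. \<forall>f\<in>M. e \<noteq> f \<longrightarrow> e \<inter> f = {})"

definition maximal_matching :: "'a set set \<Rightarrow> 'a set set \<Rightarrow> bool" where
  "maximal_matching E M \<longleftrightarrow> matching E M \<and> (\<forall>e\<in>E. e \<inter> \<Union>M \<noteq> {})"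

definition del :: "'a set set \<Rightarrow> 'a set \<Rightarrow> 'a set set" where
  "del E S = {e \<in> E. e \<inter> S = {}}"

text \<open>Edge domination depends on the edges only, so isolated vertices are dropped and deleted
  subgraphs become plain sets of edges.\<close>

definition wed :: "'a set set \<Rightarrow> bool" where
  "wed E \<longleftrightarrow> well_edge_dominated \<lparr>verts = \<Union>E, edges = E\<rparr>"

text \<open>An arbitrary choice, meaningful once \<open>wed E\<close> makes all maximal matchings
  equally large (\<open>card_maximal_matching\<close>). Maximal refers to inclusion
  throughout.\<close>

definition nu :: "'a set set \<Rightarrow> nat" where
  "nu E = card (SOME M. maximal_matching E M)"

lemma well_edge_dominated_iff_wed: "well_edge_dominated G \<longleftrightarrow> wed (edges G)"
  by (simp add: wed_def well_edge_dominated_def minimal_edge_dominating_def edge_dominating_def)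

lemma edge_set_subset: "edge_set E \<Longrightarrow> E' \<subseteq> E \<Longrightarrow> edge_set E'"
  unfolding edge_set_def by (meson finite_subset subset_iff)

lemma edge_set_del [simp]: "edge_set E \<Longrightarrow> edge_set (del E S)"
  by (erule edge_set_subset) (auto simp: del_def)

lemma edge_nonempty: "edge_set E \<Longrightarrow> e \<in> E \<Longrightarrow> e \<noteq> {}"
  unfolding edge_set_def by fastforce

lemma edge_neq: "edge_set E \<Longrightarrow> {a, b} \<in> E \<Longrightarrow> a \<noteq> b"
  unfolding edge_set_def by fastforce

lemma edge_cases:
  assumes "edge_set E" "e \<in> E"
  obtains a b where "e = {a, b}" "a \<noteq> b"
  using assms unfolding edge_set_def by (meson card_2_iff)

lemma edge_other:
  assumes "edge_set E" "e \<in> E" "a \<in> e"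
  obtains b where "e = {a, b}" "a \<noteq> b"
  using assms by (metis edge_cases doubleton_eq_iff insertE singletonD)

lemma matching_subset: "matching E M \<Longrightarrow> M \<subseteq> E"
  by (simp add: matching_def)

lemma matching_mono: "matching E M \<Longrightarrow> E \<subseteq> E' \<Longrightarrow> matching E' M"
  by (auto simp: matching_def)

lemma matching_sub: "matching E M \<Longrightarrow> M' \<subseteq> M \<Longrightarrow> matching E M'"
  unfolding matching_def by blast

lemma matching_empty [simp]: "matching E {}"
  by (simp add: matching_def)

lemma matching_disjoint: "matching E M \<Longrightarrow> e \<in> M \<Longrightarrow> f \<in> M \<Longrightarrow> a \<in> e \<Longrightarrow> a \<in> f \<Longrightarrow> e = f"
  unfolding matching_def by blast

lemma finite_matching: "edge_set E \<Longrightarrow> matching E M \<Longrightarrow> finite M"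
  unfolding edge_set_def matching_def by (meson finite_subset)

lemma maximal_matchingD: "maximal_matching E M \<Longrightarrow> matching E M"
  by (simp add: maximal_matching_def)

lemma matching_insert:
  assumes "matching E M" "e \<in> E" "e \<inter> \<Union>M = {}"
  shows "matching E (insert e M)"
  using assms unfolding matching_def by blast

lemma card_matching_insert:
  assumes "edge_set E" "matching E M" "e \<in> E" "e \<inter> \<Union>M = {}"
  shows "card (insert e M) = Suc (card M)"
proof -
  have "e \<notin> M" using assms edge_nonempty by blast
  then show ?thesis using finite_matching[OF assms(1,2)] by simp
qed

lemma matching_Un:
  assumes "matching E M" "matching E N" "\<Union>M \<inter> \<Union>N = {}"
  shows "matching E (M \<union> N)"
proof -
  have "e \<inter> f = {}" "f \<inter> e = {}" if "e \<in> M" "f \<in> N" for e f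
    using that assms(3) by blast+
  then show ?thesis
    using assms(1,2) unfolding matching_def by (metis Un_iff Un_subset_iff)
qed

lemma card_matching_Un:
  assumes "edge_set E" "matching E M" "matching E N" "\<Union>M \<inter> \<Union>N = {}"
  shows "card (M \<union> N) = card M + card N"
proof -
  have "e \<notin> N" if "e \<in> M" for e
    using that edge_nonempty[OF assms(1), of e] matching_subset[OF assms(2)] assms(4) by blast
  then have "M \<inter> N = {}" by blast
  then show ?thesis
    using finite_matching[OF assms(1,2)] finite_matching[OF assms(1,3)] card_Un_disjoint by blast
qed

lemma Union_matching_remove:
  assumes "matching E M" "e \<in> M"
  shows "\<Union>(M - {e}) = \<Union>M - e"
  using assms unfolding matching_def by blast

lemma matching_extend:
  assumes E: "edge_set E" and M: "matching E M"
  obtains M' where "M \<subseteq> M'" "maximal_matching E M'"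
proof -
  define A where "A = {M'. matching E M' \<and> M \<subseteq> M'}"
  have "finite A"
    using E unfolding A_def edge_set_def matching_def by (auto intro: finite_subset[of _ "Pow E"])
  moreover have "A \<noteq> {}" using M A_def by blast
  ultimately obtain N where "N \<in> A" and max: "\<forall>N'\<in>A. N \<subseteq> N' \<longrightarrow> N = N'"
    using finite_has_maximal by metis
  then have N: "matching E N" "M \<subseteq> N" by (auto simp: A_def)
  have "e \<inter> \<Union>N \<noteq> {}" if e: "e \<in> E" for e
  proof
    assume d: "e \<inter> \<Union>N = {}"
    then have "insert e N \<in> A" using N e matching_insert[OF N(1)] by (auto simp: A_def)
    then have "e \<in> N" using max by blast
    then show False using d e edge_nonempty[OF E] by blast
  qed
  then show thesis using that[of N] N by (auto simp: maximal_matching_def)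
qed

lemma maximal_matching_ex:
  assumes "edge_set E"
  obtains M where "maximal_matching E M"
  using matching_extend[OF assms matching_empty] by blast

section \<open>Minimal dominating sets and deleted matchings\<close>

abbreviation minimal_dominating :: "'a set set \<Rightarrow> 'a set set \<Rightarrow> bool" where
  "minimal_dominating E F \<equiv> minimal_edge_dominating \<lparr>verts = \<Union>E, edges = E\<rparr> F"

text \<open>An edge of \<open>K\<close> meets neither an edge of \<open>F\<close> nor another edge
  of \<open>K\<close>, so nothing else in \<open>F \<union> K\<close> dominates it and it cannot be
  dropped. Edges that avoid the vertices of \<open>K\<close> are dominated through \<open>F\<close>
  alone, so dropping an edge of \<open>F\<close> contradicts the minimality of
  \<open>F\<close>.\<close>

lemma minimal_dominating_Un_matching:
  assumes E: "edge_set E" and K: "matching E K" and F: "minimal_dominating (del E (\<Union>K)) F"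
  shows "minimal_dominating E (F \<union> K)"
proof -
  have dF: "F \<subseteq> del E (\<Union>K)"
    and domF: "\<And>e. e \<in> del E (\<Union>K) \<Longrightarrow> e \<in> F \<or> (\<exists>f\<in>F. e \<inter> f \<noteq> {})"
    and minF: "\<And>F'. F' \<subset> F \<Longrightarrow> \<not> edge_dominating \<lparr>verts = \<Union>(del E (\<Union>K)), edges = del E (\<Union>K)\<rparr> F'"
    using F by (auto simp: minimal_edge_dominating_def edge_dominating_def)
  have "edge_dominating \<lparr>verts = \<Union>E, edges = E\<rparr> (F \<union> K)"
    unfolding edge_dominating_def
  proof (intro conjI ballI)
    show "F \<union> K \<subseteq> edges \<lparr>verts = \<Union>E, edges = E\<rparr>"
      using dF matching_subset[OF K] by (auto simp: del_def)
    fix e assume "e \<in> edges \<lparr>verts = \<Union>E, edges = E\<rparr>"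
    then show "e \<in> F \<union> K \<or> (\<exists>f\<in>F \<union> K. e \<inter> f \<noteq> {})"
      using domF[of e] by (cases "e \<inter> \<Union>K = {}") (auto simp: del_def)
  qed
  moreover have "\<not> edge_dominating \<lparr>verts = \<Union>E, edges = E\<rparr> F'" if F': "F' \<subset> F \<union> K" for F'
  proof
    assume "edge_dominating \<lparr>verts = \<Union>E, edges = E\<rparr> F'"
    then have dom: "\<And>e. e \<in> E \<Longrightarrow> e \<in> F' \<or> (\<exists>f\<in>F'. e \<inter> f \<noteq> {})"
      by (auto simp: edge_dominating_def)
    obtain g where g: "g \<in> F \<union> K" "g \<notin> F'" using F' by blast
    show False
    proof (cases "g \<in> K")
      case True
      then have "g \<in> E" using matching_subset[OF K] by blast
      then obtain f where f: "f \<in> F'" "g \<inter> f \<noteq> {}" using dom g by blast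
      then have "f \<in> F \<or> f \<in> K" using F' by blast
      then show False
      proof
        assume "f \<in> F" then show False using dF True f by (auto simp: del_def)
      next
        assume "f \<in> K"
        then have "g = f" using matching_disjoint[OF K True, of f] f(2) by blast
        then show False using f(1) g(2) by blast
      qed
    next
      case False
      then have "F' \<inter> F \<subset> F" using g by blast
      moreover have "edge_dominating \<lparr>verts = \<Union>(del E (\<Union>K)), edges = del E (\<Union>K)\<rparr> (F' \<inter> F)"
        unfolding edge_dominating_def
      proof (intro conjI ballI)
        show "F' \<inter> F \<subseteq> edges \<lparr>verts = \<Union>(del E (\<Union>K)), edges = del E (\<Union>K)\<rparr>"
          using dF by auto
        fix e assume "e \<in> edges \<lparr>verts = \<Union>(del E (\<Union>K)), edges = del E (\<Union>K)\<rparr>"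
        then have e: "e \<in> E" "e \<inter> \<Union>K = {}" by (auto simp: del_def)
        show "e \<in> F' \<inter> F \<or> (\<exists>f\<in>F' \<inter> F. e \<inter> f \<noteq> {})"
        proof (cases "e \<in> F'")
          case True
          then have "e \<in> F" using F' e edge_nonempty[OF E e(1)] by blast
          then show ?thesis using True by blast
        next
          case False
          then obtain f where "f \<in> F'" "e \<inter> f \<noteq> {}" using dom e by blast
          moreover from this have "f \<in> F" using F' e by blast
          ultimately show ?thesis by blast
        qed
      qed
      ultimately show False using minF by blast
    qed
  qed
  ultimately show ?thesis by (simp add: minimal_edge_dominating_def)
qed

lemma maximal_matching_minimal_dominating:
  assumes E: "edge_set E" and M: "maximal_matching E M"
  shows "minimal_dominating E M"
proof -
  have "del E (\<Union>M) = {}" using M by (auto simp: maximal_matching_def del_def)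
  then have "minimal_dominating (del E (\<Union>M)) {}"
    by (simp add: minimal_edge_dominating_def edge_dominating_def)
  then show ?thesis
    using minimal_dominating_Un_matching[OF E maximal_matchingD[OF M]] by fastforce
qed

lemma card_maximal_matching:
  assumes E: "edge_set E" and w: "wed E" and M: "maximal_matching E M"
  shows "card M = nu E"
proof -
  have "maximal_matching E (SOME M. maximal_matching E M)" using M by (rule someI)
  then show ?thesis
    using maximal_matching_minimal_dominating[OF E] w M
    unfolding nu_def wed_def well_edge_dominated_def by blast
qed

lemma card_matching_le:
  assumes E: "edge_set E" and w: "wed E" and M: "matching E M"
  shows "card M \<le> nu E"
  by (metis E M card_maximal_matching card_mono finite_matching matching_extend
      maximal_matchingD w)

text \<open>The counting device behind most later adjacencies: a matching is built one edge too
  small, and the free edge it leaves can lie in few places only.\<close>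

lemma matching_extendable:
  assumes E: "edge_set E" and w: "wed E" and M: "matching E M" and c: "card M < nu E"
  obtains e where "e \<in> E" "e \<inter> \<Union>M = {}"
  using card_maximal_matching[OF E w, of M] M c unfolding maximal_matching_def by fastforce

lemma maximal_matchingI_card:
  assumes E: "edge_set E" and w: "wed E" and M: "matching E M" and c: "card M = nu E"
  shows "maximal_matching E M"
  unfolding maximal_matching_def
proof (intro conjI ballI notI)
  fix e assume "e \<in> E" "e \<inter> \<Union>M = {}"
  then show False
    using card_matching_insert[OF E M] card_matching_le[OF E w matching_insert[OF M]] c
    by fastforce
qed (rule M)

text \<open>Adding \<open>K\<close> turns minimal dominating sets of the smaller edge set into
  minimal dominating sets of \<open>E\<close>, and maximal matchings into maximal matchings. Both
  additions raise the size by \<open>card K\<close>.\<close>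

lemma
  assumes E: "edge_set E" and w: "wed E" and K: "matching E K"
  shows wed_del: "wed (del E (\<Union>K))"
    and nu_del: "nu E = card K + nu (del E (\<Union>K))"
proof -
  have c: "card (F \<union> K) = card F + card K" if "F \<subseteq> del E (\<Union>K)" for F
  proof (rule card_Un_disjoint)
    show "finite F" "finite K"
      using that E K by (auto simp: edge_set_def del_def matching_def intro: finite_subset)
    show "F \<inter> K = {}"
      using that edge_nonempty[OF E] by (fastforce simp: del_def)
  qed
  show 1: "wed (del E (\<Union>K))"
    unfolding wed_def well_edge_dominated_def
  proof (intro allI impI)
    fix F F'
    assume "minimal_dominating (del E (\<Union>K)) F \<and> minimal_dominating (del E (\<Union>K)) F'"
    then have F: "minimal_dominating (del E (\<Union>K)) F" "minimal_dominating (del E (\<Union>K)) F'"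
      by auto
    then have "card (F \<union> K) = card (F' \<union> K)"
      using minimal_dominating_Un_matching[OF E K] w unfolding wed_def well_edge_dominated_def by blast
    moreover have "F \<subseteq> del E (\<Union>K)" "F' \<subseteq> del E (\<Union>K)"
      using F by (auto simp: minimal_edge_dominating_def edge_dominating_def)
    ultimately show "card F = card F'" using c by simp
  qed
  obtain M where M: "maximal_matching (del E (\<Union>K)) M"
    using maximal_matching_ex edge_set_del[OF E] by blast
  have sub: "M \<subseteq> del E (\<Union>K)" using M by (simp add: maximal_matching_def matching_def)
  have MK: "\<Union>M \<inter> \<Union>K = {}" using sub by (auto simp: del_def)
  have "matching E (M \<union> K)"
    using matching_Un[OF _ K MK] M by (auto simp: maximal_matching_def matching_def del_def)
  moreover have "e \<inter> \<Union>(M \<union> K) \<noteq> {}" if "e \<in> E" for e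
  proof (cases "e \<in> del E (\<Union>K)")
    case True
    then have "e \<inter> \<Union>M \<noteq> {}" using M by (simp add: maximal_matching_def)
    then show ?thesis by blast
  next
    case False
    then show ?thesis using that by (auto simp: del_def)
  qed
  ultimately have "maximal_matching E (M \<union> K)" by (simp add: maximal_matching_def)
  then show "nu E = card K + nu (del E (\<Union>K))"
    using card_maximal_matching[OF E w] c[OF sub] card_maximal_matching[OF edge_set_del[OF E] 1 M]
    by fastforce
qed

text \<open>Deleting the vertices of a maximal matching of one summand leaves exactly the other
  summand, so the deletion lemmas apply. The auxiliary fact is proved for arbitrary sets because
  both orders of the summands occur.\<close>

lemma
  assumes E: "edge_set (E1 \<union> E2)" and w: "wed (E1 \<union> E2)" and d: "\<Union>E1 \<inter> \<Union>E2 = {}"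
  shows wed_Un1: "wed E1" and wed_Un2: "wed E2" and nu_Un: "nu (E1 \<union> E2) = nu E1 + nu E2"
proof -
  have es: "edge_set E1" "edge_set E2" using E edge_set_subset by blast+
  have *: "wed E2 \<and> nu (E1 \<union> E2) = card K + nu E2"
    if "edge_set (E1 \<union> E2)" "wed (E1 \<union> E2)" "\<Union>E1 \<inter> \<Union>E2 = {}" "maximal_matching E1 K"
    for E1 E2 K :: "'a set set"
  proof -
    have "matching (E1 \<union> E2) K" using that by (auto simp: maximal_matching_def matching_def)
    moreover have "del (E1 \<union> E2) (\<Union>K) = E2"
      using that by (auto simp: maximal_matching_def matching_def del_def)
    ultimately show ?thesis using wed_del[OF that(1,2)] nu_del[OF that(1,2)] by metis
  qed
  obtain K1 where K1: "maximal_matching E1 K1" using maximal_matching_ex es by blast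
  obtain K2 where K2: "maximal_matching E2 K2" using maximal_matching_ex es by blast
  show "wed E1" using *[of E2 E1 K2] K2 E w d by (auto simp: Un_commute Int_commute)
  then show "wed E2" "nu (E1 \<union> E2) = nu E1 + nu E2"
    using *[OF E w d K1] card_maximal_matching[OF es(1) _ K1] by auto
qed

section \<open>Odd cycles and maximal matchings\<close>

text \<open>A cycle of length \<open>2 * k + 1\<close> is a periodic map on the naturals: every
  vertex can serve as starting point, and indices need not be wrapped. The equivalence demands
  period and distinctness at once.\<close>

definition odd_cycle :: "'a set set \<Rightarrow> nat \<Rightarrow> (nat \<Rightarrow> 'a) \<Rightarrow> bool" where
  "odd_cycle E k v \<longleftrightarrow>
     (\<forall>i j. v i = v j \<longleftrightarrow> i mod (2 * k + 1) = j mod (2 * k + 1)) \<and> (\<forall>i. {v i, v (Suc i)} \<in> E)"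

lemma odd_cycle_edge: "odd_cycle E k v \<Longrightarrow> {v i, v (Suc i)} \<in> E"
  by (simp add: odd_cycle_def)

lemma odd_cycle_eq_iff:
  "odd_cycle E k v \<Longrightarrow> v i = v j \<longleftrightarrow> i mod (2 * k + 1) = j mod (2 * k + 1)"
  by (simp add: odd_cycle_def)

lemma add_mod_cancel_left: "(s + i) mod n = (s + j) mod n \<longleftrightarrow> i mod n = j mod (n::nat)"
proof
  assume "(s + i) mod n = (s + j) mod n"
  then have "int n dvd (int s + int i) - (int s + int j)"
    by (metis mod_eq_dvd_iff of_nat_add of_nat_mod)
  then have "int n dvd int i - int j" by simp
  then show "i mod n = j mod n"
    by (metis mod_eq_dvd_iff of_nat_mod of_nat_eq_iff)
next
  assume "i mod n = j mod n"
  then show "(s + i) mod n = (s + j) mod n" by (metis mod_add_right_eq)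
qed

lemma odd_cycle_shift: "odd_cycle E k v \<Longrightarrow> odd_cycle E k (\<lambda>i. v (s + i))"
  by (simp add: odd_cycle_def add_mod_cancel_left)

lemma odd_cycle_range_from:
  assumes "odd_cycle E k v"
  shows "range v = (\<lambda>i. v (s + i)) ` {..2 * k}"
proof -
  let ?n = "2 * k + 1"
  have "v m \<in> (\<lambda>i. v (s + i)) ` {..2 * k}" for m
  proof
    let ?r = "(m + ?n * s - s) mod ?n"
    show "?r \<in> {..2 * k}" by (simp add: less_Suc_eq_le[symmetric])
    have "(s + ?r) mod ?n = (s + (m + ?n * s - s)) mod ?n" by presburger
    also have "s + (m + ?n * s - s) = m + ?n * s" by simp
    also have "(m + ?n * s) mod ?n = m mod ?n" by (rule mod_mult_self2)
    finally have "(s + ?r) mod ?n = m mod ?n" .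
    then show "v m = v (s + ?r)" using odd_cycle_eq_iff[OF assms] by metis
  qed
  then show ?thesis by auto
qed

lemma odd_cycle_inj:
  assumes "odd_cycle E k v"
  shows "inj_on (\<lambda>i. v (s + i)) {..2 * k}"
  using odd_cycle_eq_iff[OF odd_cycle_shift[OF assms, of s]] by (auto simp: inj_on_def)

lemma odd_cycle_wrap: "odd_cycle E k v \<Longrightarrow> v (s + (2 * k + 1)) = v s"
  using odd_cycle_eq_iff[of E k v] by (metis mod_add_self2)

definition path_matching :: "(nat \<Rightarrow> 'a) \<Rightarrow> nat \<Rightarrow> 'a set set" where
  "path_matching w k = (\<lambda>i. {w (2 * i), w (2 * i + 1)}) ` {..<k}"

lemma path_matching_Suc:
  "path_matching w (Suc k) = insert {w (2 * k), w (2 * k + 1)} (path_matching w k)"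
  by (simp add: path_matching_def lessThan_Suc)

lemma lessThan_double_Suc: "{..<2 * Suc k} = insert (2 * k) (insert (2 * k + 1) {..<2 * k})"
  by auto

lemma path_matching:
  assumes E: "edge_set E" and inj: "inj_on w {..<2 * k}" and e: "\<And>i. {w i, w (Suc i)} \<in> E"
  shows "matching E (path_matching w k)" "\<Union>(path_matching w k) = w ` {..<2 * k}"
    "card (path_matching w k) = k"
proof -
  have "matching E (path_matching w k) \<and> \<Union>(path_matching w k) = w ` {..<2 * k}
      \<and> card (path_matching w k) = k"
    using inj
  proof (induction k)
    case 0
    then show ?case by (simp add: path_matching_def)
  next
    case (Suc k)
    have IH: "matching E (path_matching w k)" "\<Union>(path_matching w k) = w ` {..<2 * k}"
      "card (path_matching w k) = k"
      using Suc.IH inj_on_subset[OF Suc.prems, of "{..<2 * k}"] by auto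
    have d: "{w (2 * k), w (2 * k + 1)} \<inter> \<Union>(path_matching w k) = {}"
      using Suc.prems unfolding IH(2) lessThan_double_Suc by (auto simp: inj_on_def)
    have ed: "{w (2 * k), w (2 * k + 1)} \<in> E" using e[of "2 * k"] by simp
    show ?case
      unfolding path_matching_Suc
      using matching_insert[OF IH(1) ed d] card_matching_insert[OF E IH(1) ed d] IH(2,3)
      unfolding lessThan_double_Suc by auto
  qed
  then show "matching E (path_matching w k)" "\<Union>(path_matching w k) = w ` {..<2 * k}"
    "card (path_matching w k) = k" by auto
qed

lemma odd_cycle_path_matching:
  assumes E: "edge_set E" and c: "odd_cycle E k v" and l: "l \<le> k"
  shows "matching E (path_matching (\<lambda>i. v (s + i)) l)"
    "\<Union>(path_matching (\<lambda>i. v (s + i)) l) = (\<lambda>i. v (s + i)) ` {..<2 * l}"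
    "card (path_matching (\<lambda>i. v (s + i)) l) = l"
proof -
  have i: "inj_on (\<lambda>i. v (s + i)) {..<2 * l}"
    using odd_cycle_inj[OF c, of s] by (rule inj_on_subset) (use l in auto)
  have e: "{v (s + i), v (s + Suc i)} \<in> E" for i using odd_cycle_edge[OF c, of "s + i"] by simp
  show "matching E (path_matching (\<lambda>i. v (s + i)) l)"
    "\<Union>(path_matching (\<lambda>i. v (s + i)) l) = (\<lambda>i. v (s + i)) ` {..<2 * l}"
    "card (path_matching (\<lambda>i. v (s + i)) l) = l"
    using path_matching[OF E i e] by blast+
qed

text \<open>An odd cycle is factor-critical: the \<open>2 * k\<close> vertices after
  \<open>v s\<close> form a path whose alternate edges cover it.\<close>

lemma odd_cycle_near_perfect:
  assumes E: "edge_set E" and c: "odd_cycle E k v"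
  shows "\<Union>(path_matching (\<lambda>i. v (Suc s + i)) k) = range v - {v s}"
proof -
  have "{..2 * k} = insert 0 (Suc ` {..<2 * k})"
    by (simp add: lessThan_Suc_atMost[symmetric] lessThan_Suc_eq_insert_0)
  then have "range v = insert (v s) ((\<lambda>i. v (Suc s + i)) ` {..<2 * k})"
    using odd_cycle_range_from[OF c, of s] by (simp add: image_image)
  moreover have "v s \<notin> (\<lambda>i. v (Suc s + i)) ` {..<2 * k}"
  proof
    assume "v s \<in> (\<lambda>i. v (Suc s + i)) ` {..<2 * k}"
    then obtain i where "i < 2 * k" "v s = v (Suc s + i)" by blast
    then have "(\<lambda>i. v (s + i)) 0 = (\<lambda>i. v (s + i)) (Suc i)" by simp
    then have "0 = Suc i" using inj_onD[OF odd_cycle_inj[OF c, of s]] \<open>i < 2 * k\<close> by fastforce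
    then show False by simp
  qed
  ultimately show ?thesis
    using odd_cycle_path_matching(2)[OF E c order_refl, of "Suc s"] by (metis Diff_insert_absorb)
qed

text \<open>A factor-critical set \<open>S\<close> of \<open>2k + 1\<close> vertices that is a component of every graph obtained
  by deleting a maximal matching outside \<open>S\<close>.\<close>

definition solid :: "'a set set \<Rightarrow> 'a set \<Rightarrow> nat \<Rightarrow> bool" where
  "solid E S k \<longleftrightarrow>
     (\<forall>s\<in>S. \<exists>N. matching E N \<and> \<Union>N = S - {s} \<and> card N = k) \<and>
     (\<forall>M. maximal_matching (del E S) M \<longrightarrow> (\<forall>e\<in>E. e \<inter> S \<noteq> {} \<longrightarrow> e \<subseteq> S \<union> \<Union>M))"

lemma maximal_matching_del:
  assumes "maximal_matching (del E S) M"
  shows "matching E M" "\<Union>M \<inter> S = {}" "e \<in> E \<Longrightarrow> e \<inter> S = {} \<Longrightarrow> e \<inter> \<Union>M \<noteq> {}"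
  using assms by (auto simp: maximal_matching_def matching_def del_def)

text \<open>If an unmatched vertex outside the cycle is adjacent to it, then a count of the edges in
  suitable maximal matchings shows that all vertices \<open>v i, v (i + 2), \<dots>\<close> have one and the same
  unmatched neighbour, which then forms a triangle with an edge of the cycle.\<close>

lemma solid_odd_cycle:
  assumes E: "edge_set E" and w: "wed E" and c: "odd_cycle E k v" and k: "1 \<le> k"
    and no_tri: "\<And>u i. u \<notin> range v \<Longrightarrow> {v i, u} \<in> E \<Longrightarrow> {v (Suc i), u} \<notin> E"
  shows "solid E (range v) k"
  unfolding solid_def
proof (intro conjI ballI allI impI)
  fix s assume "s \<in> range v"
  then obtain i where "s = v i" by blast
  then show "\<exists>N. matching E N \<and> \<Union>N = range v - {s} \<and> card N = k"
    using odd_cycle_path_matching(1,3)[OF E c order_refl, of "Suc i"] odd_cycle_near_perfect[OF E c, of i]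
    by metis
next
  define S where "S = range v"
  fix M e assume "maximal_matching (del E (range v)) M" "e \<in> E" "e \<inter> range v \<noteq> {}"
  then have M: "maximal_matching (del E S) M" and e: "e \<in> E" "e \<inter> S \<noteq> {}" by (simp_all add: S_def)
  have vS: "v i \<in> S" for i by (simp add: S_def)
  note near = odd_cycle_near_perfect[OF E c, folded S_def]
  note M1 = maximal_matching_del(1)[OF M]
  note M2 = maximal_matching_del(2)[OF M]
  define adj where "adj i u \<longleftrightarrow> {v i, u} \<in> E \<and> u \<notin> S \<and> u \<notin> \<Union>M" for i u
  define N where "N i = M \<union> path_matching (\<lambda>j. v (Suc i + j)) k" for i
  have N: "matching E (N i)" "card (N i) = card M + k" "\<Union>(N i) = \<Union>M \<union> (S - {v i})" for i
  proof -
    note p = odd_cycle_path_matching[OF E c order_refl, of "Suc i"]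
    have d: "\<Union>M \<inter> \<Union>(path_matching (\<lambda>j. v (Suc i + j)) k) = {}"
      using M2 near[of i] by blast
    show "matching E (N i)" unfolding N_def by (rule matching_Un[OF M1 p(1) d])
    show "card (N i) = card M + k"
      unfolding N_def using card_matching_Un[OF E M1 p(1) d] p(3) by simp
    show "\<Union>(N i) = \<Union>M \<union> (S - {v i})"
      unfolding N_def using near[of i] by auto
  qed
  have N': "matching E (insert {v i, u} (N i))" "card (insert {v i, u} (N i)) = Suc (card M + k)"
    if "adj i u" for i u
  proof -
    have "{v i, u} \<inter> \<Union>(N i) = {}" "{v i, u} \<in> E" using that M2 N(3)[of i] vS[of i] by (auto simp: adj_def)
    then show "matching E (insert {v i, u} (N i))" "card (insert {v i, u} (N i)) = Suc (card M + k)"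
      using matching_insert[OF N(1)] card_matching_insert[OF E N(1)] N(2) by auto
  qed
  have "e \<subseteq> S \<union> \<Union>M"
  proof (rule ccontr)
    assume ne: "\<not> e \<subseteq> S \<union> \<Union>M"
    obtain i0 where i0: "v i0 \<in> e" using e(2) unfolding S_def by blast
    obtain u0 where u0: "e = {v i0, u0}" using edge_other[OF E e(1) i0] by blast
    then have a0: "adj i0 u0" using ne e(1) vS[of i0] by (auto simp: adj_def)
    have missed: "\<exists>u. f = {v i, u} \<and> adj i u" if "f \<in> E" "f \<inter> \<Union>(N i) = {}" for f i
    proof -
      have d: "f \<inter> \<Union>M = {}" "f \<inter> (S - {v i}) = {}" using that(2) unfolding N(3) by auto
      then have "f \<inter> S \<noteq> {}" using maximal_matching_del(3)[OF M that(1)] by argo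
      then have "v i \<in> f" using d(2) by blast
      then obtain u where u: "f = {v i, u}" "v i \<noteq> u" by (rule edge_other[OF E \<open>f \<in> E\<close>])
      then have "adj i u" using that(1) d unfolding adj_def by blast
      then show ?thesis using u by blast
    qed
    \<comment> \<open>A maximal \<open>N i\<close> would have one edge fewer than the matching that
      \<open>adj i0 u0\<close> provides, against the common size. So every \<open>N i\<close> leaves
      a free edge, and by \<open>missed\<close> it ends at \<open>v i\<close>.\<close>
    have ex: "\<exists>u. adj i u" for i
    proof (rule ccontr)
      assume "\<nexists>u. adj i u"
      then have "maximal_matching E (N i)"
        using missed[of _ i] N(1)[of i] unfolding maximal_matching_def by blast
      then have "nu E = card M + k" using card_maximal_matching[OF E w] N(2) by metis
      then show False using card_matching_le[OF E w N'(1)[OF a0]] N'(2)[OF a0] by simp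
    qed
    have nuE: "nu E = Suc (card M + k)"
    proof -
      have "maximal_matching E (insert {v i0, u0} (N i0))"
        unfolding maximal_matching_def
      proof (intro conjI ballI notI)
        show "matching E (insert {v i0, u0} (N i0))" by (rule N'(1)[OF a0])
        fix f assume f: "f \<in> E" "f \<inter> \<Union>(insert {v i0, u0} (N i0)) = {}"
        then have "v i0 \<in> f" using missed[of f i0] by blast
        then show False using f(2) by blast
      qed
      then show ?thesis using card_maximal_matching[OF E w] N'(2)[OF a0] by metis
    qed
    \<comment> \<open>With different neighbours, \<open>v i\<close>, \<open>v (i + 1)\<close> and
      \<open>v (i + 2)\<close> could be matched to three distinct outside vertices;
      \<open>no_tri\<close> separates \<open>u2\<close> from the other two. Together with
      \<open>M\<close> and \<open>k - 1\<close> edges on the remaining \<open>2 * k - 2\<close>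
      cycle vertices this exceeds \<open>nu E\<close> by one.\<close>
    have same: "u = u'" if u: "adj i u" and u': "adj (i + 2) u'" for i u u'
    proof (rule ccontr)
      assume "u \<noteq> u'"
      obtain u2 where u2: "adj (i + 1) u2" using ex by blast
      have ne2: "u2 \<noteq> u" "u2 \<noteq> u'"
        using no_tri[of u2 i] no_tri[of u2 "i + 1"] u u' u2 by (auto simp: adj_def S_def)
      let ?P = "path_matching (\<lambda>j. v (i + 3 + j)) (k - 1)"
      have kk: "k - 1 \<le> k" by simp
      note p = odd_cycle_path_matching[OF E c kk, of "i + 3"]
      have inj: "v (i + a) = v (i + b) \<Longrightarrow> a = b" if "a \<le> 2 * k" "b \<le> 2 * k" for a b
        using inj_onD[OF odd_cycle_inj[OF c, of i], of a b] that by simp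
      have notP: "v (i + a) \<notin> \<Union>?P" if "a < 3" for a
      proof
        assume "v (i + a) \<in> \<Union>?P"
        then obtain j where j: "j < 2 * (k - 1)" "v (i + a) = v (i + (3 + j))"
          unfolding p(2) by (auto simp: add.assoc)
        then show False using inj[of a "3 + j"] that k by linarith
      qed
      have d3: "v i \<noteq> v (i + 1)" "v i \<noteq> v (i + 2)" "v (i + 1) \<noteq> v (i + 2)"
        using inj[of 0 1] inj[of 0 2] inj[of 1 2] k by auto
      have PS: "\<Union>?P \<subseteq> S" unfolding p(2) S_def by blast
      define Q0 where "Q0 = M \<union> ?P"
      have Q0: "matching E Q0" "card Q0 = card M + (k - 1)" "\<Union>Q0 = \<Union>M \<union> \<Union>?P"
        using matching_Un[OF M1 p(1)] card_matching_Un[OF E M1 p(1)] p(3) PS M2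
        unfolding Q0_def by auto
      define Q1 where "Q1 = insert {v i, u} Q0"
      have d: "{v i, u} \<in> E" "{v i, u} \<inter> \<Union>Q0 = {}"
        using u M2 PS notP[of 0] vS unfolding Q0(3) adj_def by auto
      then have Q1: "matching E Q1" "card Q1 = Suc (card Q0)" "\<Union>Q1 = {v i, u} \<union> \<Union>Q0"
        using matching_insert[OF Q0(1)] card_matching_insert[OF E Q0(1)] unfolding Q1_def by auto
      define Q2 where "Q2 = insert {v (i + 1), u2} Q1"
      have d: "{v (i + 1), u2} \<in> E" "{v (i + 1), u2} \<inter> \<Union>Q1 = {}"
        using u u2 ne2 d3 M2 PS notP[of 1] vS unfolding Q1(3) Q0(3) adj_def by auto
      then have Q2: "matching E Q2" "card Q2 = Suc (card Q1)" "\<Union>Q2 = {v (i + 1), u2} \<union> \<Union>Q1"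
        using matching_insert[OF Q1(1)] card_matching_insert[OF E Q1(1)] unfolding Q2_def by auto
      define Q3 where "Q3 = insert {v (i + 2), u'} Q2"
      have d: "{v (i + 2), u'} \<in> E" "{v (i + 2), u'} \<inter> \<Union>Q2 = {}"
        using u u' u2 ne2 \<open>u \<noteq> u'\<close> d3 M2 PS notP[of 2] vS unfolding Q2(3) Q1(3) Q0(3) adj_def by auto
      then have "matching E Q3" "card Q3 = Suc (card Q2)"
        using matching_insert[OF Q2(1)] card_matching_insert[OF E Q2(1)] unfolding Q3_def by auto
      then have "card M + (k - 1) + 3 \<le> nu E"
        using card_matching_le[OF E w, of Q3] Q2(2) Q1(2) Q0(2) by simp
      then show False using nuE k by linarith
    qed
    \<comment> \<open>Steps of two carry \<open>u0\<close> round the cycle: after \<open>k\<close>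
      of them comes \<open>v (i0 + 2 * k)\<close>, the predecessor of \<open>v i0\<close>.\<close>
    have "adj (i0 + 2 * m) u0" for m
    proof (induction m)
      case 0
      then show ?case using a0 by simp
    next
      case (Suc m)
      obtain u' where "adj (i0 + 2 * m + 2) u'" using ex by blast
      then show ?case using same[OF Suc] by (simp add: add.assoc)
    qed
    from this[of k] have "{v (i0 + 2 * k), u0} \<in> E" "u0 \<notin> range v" by (auto simp: adj_def S_def)
    then have "{v (Suc (i0 + 2 * k)), u0} \<notin> E" using no_tri by blast
    moreover have "v (Suc (i0 + 2 * k)) = v i0" using odd_cycle_wrap[OF c, of i0] by simp
    ultimately show False using a0 by (simp add: adj_def)
  qed
  then show "e \<subseteq> range v \<union> \<Union>M" by (simp add: S_def)
qed

lemma solid_closed: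
  "solid E S k \<Longrightarrow> maximal_matching (del E S) M \<Longrightarrow> e \<in> E \<Longrightarrow> e \<inter> S \<noteq> {} \<Longrightarrow> e \<subseteq> S \<union> \<Union>M"
  by (simp add: solid_def)

lemma solid_near_perfect:
  assumes "solid E S k" "s \<in> S"
  obtains N where "matching E N" "\<Union>N = S - {s}" "card N = k"
  using assms unfolding solid_def by metis

text \<open>A matching that covers \<open>S\<close> except \<open>s\<close> is added to
  \<open>M\<close>. Every neighbour of \<open>s\<close> lies in \<open>S\<close> or is matched by
  \<open>M\<close>, so the union is already maximal.\<close>

lemma nu_solid:
  assumes E: "edge_set E" and w: "wed E" and S: "solid E S k" and s: "s \<in> S"
    and M: "maximal_matching (del E S) M"
  shows "nu E = card M + k"
proof -
  note M1 = maximal_matching_del[OF M]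
  obtain N where N: "matching E N" "\<Union>N = S - {s}" "card N = k"
    by (rule solid_near_perfect[OF S s])
  have d: "\<Union>M \<inter> \<Union>N = {}" using M1(2) unfolding N(2) by blast
  have "f \<inter> \<Union>(M \<union> N) \<noteq> {}" if f: "f \<in> E" for f
  proof (cases "f \<inter> S = {}")
    case True
    then have "f \<inter> \<Union>M \<noteq> {}" by (rule M1(3)[OF f])
    then show ?thesis by auto
  next
    case False
    then have sub: "f \<subseteq> S \<union> \<Union>M" by (rule solid_closed[OF S M f])
    obtain a b where "f = {a, b}" "a \<noteq> b" by (rule edge_cases[OF E f])
    then show ?thesis using sub N(2) by auto
  qed
  then have "maximal_matching E (M \<union> N)"
    using matching_Un[OF M1(1) N(1) d] by (simp add: maximal_matching_def)
  then show ?thesis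
    using card_maximal_matching[OF E w] card_matching_Un[OF E M1(1) N(1) d] N(3) by simp
qed

text \<open>In a maximal matching outside \<open>S\<close> that contains \<open>ab\<close>, the edge
  \<open>ab\<close> is exchanged for \<open>as\<close>, and only \<open>k - 1\<close> edges are used
  inside \<open>S\<close>. The result is one edge short of \<open>nu E\<close>, so a free edge
  exists. If it avoided \<open>b\<close>, solidity would force it into the uncovered part of
  \<open>S\<close>, which \<open>indep\<close> forbids; hence it joins \<open>b\<close> to that
  part.\<close>

lemma solid_neighbour:
  assumes E: "edge_set E" and w: "wed E" and S: "solid E S k" and s: "s \<in> S"
    and ab: "{a, b} \<in> E" "a \<notin> S" "b \<notin> S" and as: "{a, s} \<in> E"
    and N: "matching E N" "Suc (card N) = k" "\<Union>N \<subseteq> S - {s}"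
    and indep: "\<And>e. e \<in> E \<Longrightarrow> \<not> e \<subseteq> S - {s} - \<Union>N"
  obtains u where "u \<in> S - {s} - \<Union>N" "{b, u} \<in> E"
proof -
  have "matching (del E S) {{a, b}}" using ab by (auto simp: matching_def del_def)
  then obtain M where M: "{{a, b}} \<subseteq> M" "maximal_matching (del E S) M"
    using matching_extend[OF edge_set_del[OF E]] by blast
  note M1 = maximal_matching_del[OF M(2)]
  have nuE: "nu E = card M + k" by (rule nu_solid[OF E w S s M(2)])
  obtain N0 where N0: "matching E N0" "\<Union>N0 = S - {s}" "card N0 = k"
    by (rule solid_near_perfect[OF S s])
  define M' where "M' = M - {{a, b}}"
  have M': "matching E M'" "\<Union>M' = \<Union>M - {a, b}" "Suc (card M') = card M"
    using matching_sub[OF M1(1)] Union_matching_remove[OF M1(1), of "{a, b}"]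
      finite_matching[OF E M1(1)] M(1) card_Suc_Diff1[of M "{a, b}"] unfolding M'_def by auto
  define L where "L = insert {a, s} M'"
  have d: "{a, s} \<inter> \<Union>M' = {}" using M'(2) M1(2) s by auto
  have L: "matching E L" "card L = card M" "\<Union>L = {a, s} \<union> (\<Union>M - {a, b})"
    using matching_insert[OF M'(1) as d] card_matching_insert[OF E M'(1) as d] M'(2,3)
    unfolding L_def by auto
  have LS: "\<Union>L \<inter> (S - {s}) = {}" using L(3) ab(2) M1(2) by auto
  have d: "\<Union>L \<inter> \<Union>N = {}" using LS N(3) by blast
  have "card (L \<union> N) < nu E" using card_matching_Un[OF E L(1) N(1) d] nuE L(2) N(2) by simp
  then obtain e where e: "e \<in> E" "e \<inter> \<Union>(L \<union> N) = {}"
    using matching_extendable[OF E w matching_Un[OF L(1) N(1) d]] by blast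
  have eU: "e \<inter> S \<subseteq> S - {s} - \<Union>N" using e(2) L(3) by auto
  show thesis
  proof (cases "b \<in> e")
    case True
    obtain u where u: "e = {b, u}" using edge_other[OF E e(1) True] by blast
    \<comment> \<open>If \<open>u\<close> were outside, \<open>bu\<close> could be added to
      \<open>L\<close>, and all \<open>k\<close> edges of \<open>N0\<close> as well, which is one
      edge too many.\<close>
    have "u \<in> S"
    proof (rule ccontr)
      assume nu: "u \<notin> S"
      define L' where "L' = insert e L"
      have d1: "e \<inter> \<Union>L = {}" using e(2) by auto
      have L': "matching E L'" "card L' = Suc (card M)" "\<Union>L' = e \<union> \<Union>L"
        using matching_insert[OF L(1) e(1) d1] card_matching_insert[OF E L(1) e(1) d1] L(2)
        unfolding L'_def by auto
      have d2: "\<Union>L' \<inter> \<Union>N0 = {}" using L'(3) LS N0(2) u nu ab(3) by auto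
      show False
        using card_matching_le[OF E w matching_Un[OF L'(1) N0(1) d2]]
          card_matching_Un[OF E L'(1) N0(1) d2] L'(2) N0(3) nuE by simp
    qed
    then show thesis using that[of u] eU u e(1) by blast
  next
    case False
    have "a \<notin> e" using e(2) L(3) by auto
    then have eM: "e \<inter> \<Union>M = {}" using False e(2) L(3) by auto
    then have "e \<inter> S \<noteq> {}" using M1(3)[OF e(1)] by blast
    then have "e \<subseteq> S \<union> \<Union>M" by (rule solid_closed[OF S M(2) e(1)])
    then have "e \<subseteq> S - {s} - \<Union>N" using eM eU by blast
    then show thesis using indep[OF e(1)] by blast
  qed
qed

section \<open>Odd cycles as lists, shortest odd closed walks, chords\<close>

lemma odd_cycleI:
  assumes inj: "inj_on f {..2 * k}" and e: "\<And>i. i < 2 * k \<Longrightarrow> {f i, f (Suc i)} \<in> E"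
    and c: "{f (2 * k), f 0} \<in> E"
  shows "odd_cycle E k (\<lambda>i. f (i mod (2 * k + 1)))"
  unfolding odd_cycle_def
proof (intro conjI allI)
  fix i j
  have "i mod (2 * k + 1) \<in> {..2 * k}" "j mod (2 * k + 1) \<in> {..2 * k}"
    by (simp_all add: less_Suc_eq_le[symmetric])
  then show "f (i mod (2 * k + 1)) = f (j mod (2 * k + 1)) \<longleftrightarrow> i mod (2 * k + 1) = j mod (2 * k + 1)"
    using inj_on_eq_iff[OF inj] by blast
next
  fix i
  have le: "i mod (2 * k + 1) \<le> 2 * k" by (simp add: less_Suc_eq_le[symmetric])
  show "{f (i mod (2 * k + 1)), f (Suc i mod (2 * k + 1))} \<in> E"
  proof (cases "i mod (2 * k + 1) = 2 * k")
    case True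
    then have "Suc i mod (2 * k + 1) = 0" by (simp add: mod_Suc)
    then show ?thesis using True c by simp
  next
    case False
    then have "Suc i mod (2 * k + 1) = Suc (i mod (2 * k + 1))" by (simp add: mod_Suc)
    moreover have "i mod (2 * k + 1) < 2 * k" using False le by (rule le_neq_implies_less[rotated])
    ultimately show ?thesis using e by metis
  qed
qed

text \<open>Lists serve for short cycles whose vertices are named individually; appending the head
  supplies the closing edge. \<open>odd_cycle_list\<close> passes to the periodic form.\<close>

definition cycle_list :: "'a set set \<Rightarrow> 'a list \<Rightarrow> bool" where
  "cycle_list E xs \<longleftrightarrow>
     odd (length xs) \<and> distinct xs \<and> successively (\<lambda>a b. {a, b} \<in> E) (xs @ [hd xs])"

lemma odd_cycle_list:
  assumes "cycle_list E xs"
  obtains k v where "length xs = 2 * k + 1" "odd_cycle E k v" "range v = set xs"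
proof -
  obtain k where k: "length xs = 2 * k + 1" using assms by (auto simp: cycle_list_def elim: oddE)
  have s: "\<And>i. Suc i < length (xs @ [hd xs]) \<Longrightarrow> {(xs @ [hd xs]) ! i, (xs @ [hd xs]) ! Suc i} \<in> E"
    using assms unfolding cycle_list_def successively_conv_nth by blast
  have c: "odd_cycle E k (\<lambda>i. xs ! (i mod (2 * k + 1)))"
  proof (rule odd_cycleI)
    show "inj_on ((!) xs) {..2 * k}"
      using assms k by (auto simp: cycle_list_def inj_on_def nth_eq_iff_index_eq)
    show "{xs ! i, xs ! Suc i} \<in> E" if "i < 2 * k" for i
      using s[of i] that k by (simp add: nth_append)
    show "{xs ! (2 * k), xs ! 0} \<in> E"
      using s[of "2 * k"] k hd_conv_nth[of xs] by (fastforce simp: nth_append)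
  qed
  have "range (\<lambda>i. xs ! (i mod (2 * k + 1))) = (\<lambda>i. xs ! (i mod (2 * k + 1))) ` {..2 * k}"
    using odd_cycle_range_from[OF c, of 0] by simp
  also have "\<dots> = (!) xs ` {..2 * k}" by (rule image_cong) auto
  also have "\<dots> = set xs" using k by (auto simp: set_conv_nth less_Suc_eq_le)
  finally show thesis using that k c by blast
qed

lemma edge_subset_pair: "edge_set E \<Longrightarrow> e \<in> E \<Longrightarrow> e \<subseteq> {a, b} \<Longrightarrow> e = {a, b}"
  by (erule (1) edge_cases) auto

lemma relpow_sym: "sym R \<Longrightarrow> (a, b) \<in> R ^^ n \<Longrightarrow> (b, a) \<in> R ^^ n"
proof (induction n arbitrary: b)
  case (Suc n)
  then show ?case by (metis relpow_Suc_E relpow_Suc_I2 symD)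
qed simp

text \<open>In a shortest odd closed walk, a repeated vertex would give two closed walks of total
  length \<open>n\<close>, and a chord two of total length \<open>n + 2\<close>. One of the two has
  odd length, hence length at least \<open>n\<close>; this excludes repetitions and leaves only
  edges between neighbours on the cycle.\<close>

lemma shortest_odd_closed_walk:
  assumes R: "sym R" and walk: "(u, u) \<in> R ^^ m" "odd m"
  obtains n f where "odd n" "\<And>i. i < n \<Longrightarrow> (f i, f (Suc i)) \<in> R" "f n = f 0" "inj_on f {..<n}"
    "\<And>i j. i < j \<Longrightarrow> j < n \<Longrightarrow> (f i, f j) \<in> R \<Longrightarrow> j = Suc i \<or> i = 0 \<and> Suc j = n"
proof -
  define P where "P n \<longleftrightarrow> odd n \<and> (\<exists>u. (u, u) \<in> R ^^ n)" for n
  define n where "n = (LEAST n. P n)"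
  have "P m" using walk by (auto simp: P_def)
  then have n: "P n" unfolding n_def by (rule LeastI)
  have least: "n \<le> l" if "odd l" "(w, w) \<in> R ^^ l" for l w
    unfolding n_def by (rule Least_le) (use that in \<open>auto simp: P_def\<close>)
  obtain w where w: "(w, w) \<in> R ^^ n" and oddn: "odd n" using n by (auto simp: P_def)
  obtain f where f: "f 0 = w" "f n = w" "\<And>i. i < n \<Longrightarrow> (f i, f (Suc i)) \<in> R"
    using w unfolding relpow_fun_conv by blast
  have seg: "(f i, f (i + l)) \<in> R ^^ l" if "i + l \<le> n" for i l
    unfolding relpow_fun_conv by (rule exI[of _ "\<lambda>j. f (i + j)"]) (use that f(3) in auto)
  have inside: "(f i, f j) \<in> R ^^ (j - i)" if "i \<le> j" "j \<le> n" for i j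
    using seg[of i "j - i"] that by simp
  have outside: "(f j, f i) \<in> R ^^ (n - j + i)" if "i \<le> j" "j \<le> n" for i j
  proof -
    have "(f j, f n) \<in> R ^^ (n - j)" "(f 0, f i) \<in> R ^^ i"
      using inside[of j n] inside[of 0 i] that by simp_all
    then show ?thesis using f(1,2) unfolding relpow_add by auto
  qed
  have "f i \<noteq> f j" if "i < j" "j < n" for i j
  proof
    assume eq: "f i = f j"
    have "(f i, f i) \<in> R ^^ (j - i)" "(f i, f i) \<in> R ^^ (n - j + i)"
      using inside[of i j] outside[of i j] that eq by simp_all
    moreover have "odd (j - i) \<or> odd (n - j + i)" using oddn that by presburger
    ultimately have "n \<le> j - i \<or> n \<le> n - j + i" using least by blast
    then show False using that by linarith
  qed
  then have "inj_on f {..<n}" by (auto intro: linorder_inj_onI)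
  moreover have "j = Suc i \<or> i = 0 \<and> Suc j = n" if ij: "i < j" "j < n" and r: "(f i, f j) \<in> R" for i j
  proof -
    have "(f i, f j) \<in> R" "(f j, f i) \<in> R" using r R by (auto dest: symD)
    then have "(f i, f i) \<in> R ^^ Suc (j - i)" "(f j, f j) \<in> R ^^ Suc (n - j + i)"
      using inside[of i j] outside[of i j] ij by (auto intro: relpow_Suc_I)
    moreover have "odd (Suc (j - i)) \<or> odd (Suc (n - j + i))" using oddn ij by presburger
    ultimately have "n \<le> Suc (j - i) \<or> n \<le> Suc (n - j + i)" using least by blast
    then show ?thesis using ij by linarith
  qed
  ultimately show thesis using that[OF oddn] f by metis
qed

text \<open>The vertices \<open>v 2\<close>, \<open>v 5\<close>, \<open>v 8\<close> are left out:
  \<open>M\<close>, the edges \<open>v 0 v 1\<close>, \<open>v 3 v 4\<close>, \<open>v 6 v 7\<close>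
  and the pairs from \<open>v 9\<close> on form a matching of \<open>nu E - 1\<close> edges.
  Solidity keeps the free edge inside the cycle, so it joins two of the three. A shortest odd cycle
  has no such chord.\<close>

lemma solid_odd_cycle_chord:
  assumes E: "edge_set E" and w: "wed E" and c: "odd_cycle E k v" and S: "solid E (range v) k"
    and k: "4 \<le> k"
  shows "{v 2, v 5} \<in> E \<or> {v 2, v 8} \<in> E \<or> {v 5, v 8} \<in> E"
proof -
  obtain M where M: "maximal_matching (del E (range v)) M"
    using maximal_matching_ex[OF edge_set_del[OF E]] by blast
  note M1 = maximal_matching_del[OF M]
  have nuE: "nu E = card M + k" using nu_solid[OF E w S _ M] by blast
  define P where "P = path_matching (\<lambda>i. v (9 + i)) (k - 4)"
  have le: "k - 4 \<le> k" by simp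
  note p = odd_cycle_path_matching[OF E c le, of 9, folded P_def]
  have inj: "v a = v b \<longleftrightarrow> a = b" if "a \<le> 2 * k" "b \<le> 2 * k" for a b
    using inj_on_eq_iff[OF odd_cycle_inj[OF c, of 0], of a b] that by simp
  have notP: "v a \<notin> \<Union>P" if "a \<le> 8" for a
  proof
    assume "v a \<in> \<Union>P"
    then obtain j where "j < 2 * (k - 4)" "v a = v (9 + j)" unfolding p(2) by auto
    then show False using inj[of a "9 + j"] that k by linarith
  qed
  have PS: "\<Union>P \<subseteq> range v" unfolding p(2) by blast
  have vM: "v i \<notin> \<Union>M" for i using M1(2) by blast
  have d: "\<Union>M \<inter> \<Union>P = {}" using PS M1(2) by blast
  define Q0 where "Q0 = M \<union> P"
  have Q0: "matching E Q0" "card Q0 = card M + (k - 4)" "\<Union>Q0 = \<Union>M \<union> \<Union>P"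
    using matching_Un[OF M1(1) p(1) d] card_matching_Un[OF E M1(1) p(1) d] p(3)
    unfolding Q0_def by auto
  have neq: "v a \<noteq> v b" if "a < b" "b \<le> 8" for a b using inj[of a b] that k by simp
  define Q1 where "Q1 = insert {v 0, v 1} Q0"
  have d: "{v 0, v 1} \<inter> \<Union>Q0 = {}" unfolding Q0(3) using vM notP[of 0] notP[of 1] by auto
  have e: "{v 0, v 1} \<in> E" using odd_cycle_edge[OF c, of 0] by simp
  have Q1: "matching E Q1" "card Q1 = Suc (card Q0)" "\<Union>Q1 = {v 0, v 1} \<union> \<Union>Q0"
    using matching_insert[OF Q0(1) e d] card_matching_insert[OF E Q0(1) e d] unfolding Q1_def by auto
  define Q2 where "Q2 = insert {v 3, v 4} Q1"
  have d: "{v 3, v 4} \<inter> \<Union>Q1 = {}" unfolding Q1(3) Q0(3)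
    using vM notP[of 3] notP[of 4] neq[of 0 3] neq[of 0 4] neq[of 1 3] neq[of 1 4] by auto
  have e: "{v 3, v 4} \<in> E" using odd_cycle_edge[OF c, of 3] by simp
  have Q2: "matching E Q2" "card Q2 = Suc (card Q1)" "\<Union>Q2 = {v 3, v 4} \<union> \<Union>Q1"
    using matching_insert[OF Q1(1) e d] card_matching_insert[OF E Q1(1) e d] unfolding Q2_def by auto
  define Q3 where "Q3 = insert {v 6, v 7} Q2"
  have d: "{v 6, v 7} \<inter> \<Union>Q2 = {}" unfolding Q2(3) Q1(3) Q0(3)
    using vM notP[of 6] notP[of 7] neq[of 0 6] neq[of 0 7] neq[of 1 6] neq[of 1 7]
      neq[of 3 6] neq[of 3 7] neq[of 4 6] neq[of 4 7] by auto
  have e: "{v 6, v 7} \<in> E" using odd_cycle_edge[OF c, of 6] by simp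
  have Q3: "matching E Q3" "card Q3 = Suc (card Q2)" "\<Union>Q3 = {v 6, v 7} \<union> \<Union>Q2"
    using matching_insert[OF Q2(1) e d] card_matching_insert[OF E Q2(1) e d] unfolding Q3_def by auto
  have "card Q3 < nu E" using nuE Q3(2) Q2(2) Q1(2) Q0(2) k by linarith
  then obtain f where f: "f \<in> E" "f \<inter> \<Union>Q3 = {}" by (rule matching_extendable[OF E w Q3(1)])
  have fQ: "f \<inter> \<Union>M = {}" "f \<inter> \<Union>P = {}" "f \<inter> {v 0, v 1, v 3, v 4, v 6, v 7} = {}"
    using f(2) unfolding Q3(3) Q2(3) Q1(3) Q0(3) by auto
  have "f \<inter> range v \<noteq> {}" using M1(3)[OF f(1)] fQ(1) by argo
  then have fS: "f \<subseteq> range v" using solid_closed[OF S M f(1)] fQ(1) by blast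
  have "a \<in> {v 2, v 5, v 8}" if "a \<in> f" for a
  proof -
    obtain i where i: "i \<le> 2 * k" "a = v i"
      using fS \<open>a \<in> f\<close> odd_cycle_range_from[OF c, of 0] by fastforce
    have "i \<le> 8"
    proof (rule ccontr)
      assume "\<not> i \<le> 8"
      then have "v i = v (9 + (i - 9))" "i - 9 < 2 * (k - 4)" using i by auto
      then have "v i \<in> \<Union>P" unfolding p(2) by blast
      then show False using fQ(2) that i by blast
    qed
    then have "i \<in> {0, 1, 2, 3, 4, 5, 6, 7, 8}" by auto
    then show ?thesis using fQ(3) that i(2) by auto
  qed
  moreover obtain a b where "f = {a, b}" "a \<noteq> b" by (rule edge_cases[OF E f(1)])
  ultimately have "f = {v 2, v 5} \<or> f = {v 2, v 8} \<or> f = {v 5, v 8}" by auto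
  then show ?thesis using f(1) by auto
qed

section \<open>Odd cycles in a graph with exactly one triangle\<close>

text \<open>All hypotheses are put in terms of the edge set. Connectedness is phrased through sets
  closed under adjacency, so that it applies directly to a cycle with its neighbourhood or to a
  component.\<close>

locale unique_triangle =
  fixes E :: "'a set set" and x y z :: 'a
  assumes E: "edge_set E" and wed: "wed E"
    and xy: "{x, y} \<in> E" and xz: "{x, z} \<in> E" and yz: "{y, z} \<in> E"
    and triangle: "\<And>a b c. {a, b} \<in> E \<Longrightarrow> {b, c} \<in> E \<Longrightarrow> {a, c} \<in> E \<Longrightarrow> {a, b, c} = {x, y, z}"
    and connected: "\<And>A. A \<inter> \<Union>E \<noteq> {} \<Longrightarrow> (\<And>a b. a \<in> A \<Longrightarrow> {a, b} \<in> E \<Longrightarrow> b \<in> A) \<Longrightarrow> \<Union>E \<subseteq> A"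
begin

definition adj :: "'a \<Rightarrow> 'a \<Rightarrow> bool" where
  "adj a b \<longleftrightarrow> {a, b} \<in> E"

lemma adj_sym: "adj a b \<Longrightarrow> adj b a"
  by (simp add: adj_def insert_commute)

lemma adj_neq: "adj a b \<Longrightarrow> a \<noteq> b"
  using edge_neq[OF E] by (auto simp: adj_def)

text \<open>The pair in either order, so that arguments symmetric in \<open>x\<close> and
  \<open>y\<close> are carried out once, for \<open>p\<close> and \<open>q\<close>.\<close>

definition apex_pair :: "'a \<Rightarrow> 'a \<Rightarrow> bool" where
  "apex_pair p q \<longleftrightarrow> {p, q} = {x, y}"

lemma apex_pair_cases: "apex_pair p q \<longleftrightarrow> p = x \<and> q = y \<or> p = y \<and> q = x"
  by (auto simp: apex_pair_def doubleton_eq_iff)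

lemma apex_pair_sym: "apex_pair p q \<Longrightarrow> apex_pair q p"
  by (auto simp: apex_pair_cases)

lemma apex_pair_adj:
  assumes "apex_pair p q"
  shows "adj p q" "adj p z" "adj q z" "adj q p" "adj z p" "adj z q"
  using assms xy xz yz by (auto simp: apex_pair_cases adj_def insert_commute)

lemma no_triangle:
  assumes "adj a b" "adj b c" "adj a c"
  shows "x \<in> {a, b, c}" "y \<in> {a, b, c}" "z \<in> {a, b, c}"
  using triangle[of a b c] assms by (auto simp: adj_def)

lemma no_triangle_apex:
  assumes "apex_pair p q" "adj a b" "adj b c" "adj a c" "p \<notin> {a, b, c}"
  shows False
  using no_triangle[OF assms(2-4)] assms(1,5) by (auto simp: apex_pair_cases)

definition free_cycle :: "'a list \<Rightarrow> bool" where
  "free_cycle xs \<longleftrightarrow> cycle_list E xs \<and> x \<notin> set xs \<and> y \<notin> set xs"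

text \<open>An outside vertex adjacent to two consecutive cycle vertices would close the unique
  triangle; then \<open>x\<close> and \<open>y\<close>, which are not on the cycle, would both equal
  that vertex.\<close>

lemma solid_free_odd_cycle:
  assumes c: "odd_cycle E k v" and k: "1 \<le> k" and f: "x \<notin> range v" "y \<notin> range v"
  shows "solid E (range v) k"
proof (rule solid_odd_cycle[OF E wed c k])
  fix u i assume u: "u \<notin> range v" "{v i, u} \<in> E"
  show "{v (Suc i), u} \<notin> E"
  proof
    assume "{v (Suc i), u} \<in> E"
    then have "{v i, v (Suc i), u} = {x, y, z}"
      using triangle[OF odd_cycle_edge[OF c, of i]] u by blast
    then have "x = u" "y = u" using f by blast+
    then show False using edge_neq[OF E xy] by simp
  qed
qed

lemma solid_free_cycle:
  assumes "free_cycle xs" "length xs = 2 * k + 1" "1 \<le> k"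
  shows "solid E (set xs) k"
proof -
  have f: "cycle_list E xs" "x \<notin> set xs" "y \<notin> set xs" using assms(1) by (auto simp: free_cycle_def)
  obtain l v where v: "length xs = 2 * l + 1" "odd_cycle E l v" "range v = set xs"
    by (rule odd_cycle_list[OF f(1)])
  then show ?thesis using solid_free_odd_cycle[OF v(2)] assms(2,3) f(2,3) by auto
qed

text \<open>Specialises \<open>solid_neighbour\<close> to a matching that leaves only
  \<open>u\<close> and \<open>u'\<close> of the cycle besides \<open>s\<close>: as these are not
  adjacent, the free edge must come from \<open>b\<close>.\<close>

lemma free_cycle_neighbour:
  assumes c: "free_cycle xs" "1 < length xs" and s: "s \<in> set xs"
    and ab: "adj a s" "adj a b" "a \<notin> set xs" "b \<notin> set xs"
    and N: "matching E N" "Suc (card N) = length xs div 2" "\<Union>N \<subseteq> set xs - {s}"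
    and U: "set xs - {s} - \<Union>N \<subseteq> {u, u'}" and u: "\<not> adj u u'"
  shows "adj b u \<or> adj b u'"
proof -
  have "\<not> e \<subseteq> set xs - {s} - \<Union>N" if "e \<in> E" for e
    using edge_subset_pair[OF E that, of u u'] that U u by (auto simp: adj_def)
  moreover have "solid E (set xs) (length xs div 2)"
    by (rule solid_free_cycle[OF c(1)]) (use c in \<open>auto simp: free_cycle_def cycle_list_def\<close>)
  ultimately obtain v where "v \<in> set xs - {s} - \<Union>N" "{b, v} \<in> E"
    using solid_neighbour[OF E wed _ s _ ab(3,4) _ N] ab(1,2)
    unfolding adj_def by blast
  then show ?thesis using U unfolding adj_def by blast
qed

lemma matching_single: "adj a b \<Longrightarrow> matching E {{a, b}}"
  by (simp add: adj_def matching_def)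

lemma matching_two: "adj a b \<Longrightarrow> adj c d \<Longrightarrow> {a, b} \<inter> {c, d} = {} \<Longrightarrow> matching E {{a, b}, {c, d}}"
  unfolding adj_def matching_def by blast

lemma matching_three:
  "adj a b \<Longrightarrow> adj c d \<Longrightarrow> adj e f \<Longrightarrow> {a, b} \<inter> {c, d} = {} \<Longrightarrow> {a, b} \<inter> {e, f} = {} \<Longrightarrow>
    {c, d} \<inter> {e, f} = {} \<Longrightarrow> matching E {{a, b}, {c, d}, {e, f}}"
  unfolding adj_def matching_def by blast

section \<open>Cycles of named vertices, first of length five\<close>

lemma free_cycle_5:
  "free_cycle [a, b, c, d, e] \<longleftrightarrow>
    distinct [a, b, c, d, e] \<and> adj a b \<and> adj b c \<and> adj c d \<and> adj d e \<and> adj e a \<and>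
    x \<notin> {a, b, c, d, e} \<and> y \<notin> {a, b, c, d, e}"
  by (auto simp: free_cycle_def cycle_list_def adj_def)

lemma free_cycle_7:
  "free_cycle [a, b, c, d, e, f, g] \<longleftrightarrow>
    distinct [a, b, c, d, e, f, g] \<and> adj a b \<and> adj b c \<and> adj c d \<and> adj d e \<and> adj e f \<and>
    adj f g \<and> adj g a \<and> x \<notin> {a, b, c, d, e, f, g} \<and> y \<notin> {a, b, c, d, e, f, g}"
  by (auto simp: free_cycle_def cycle_list_def adj_def)

lemma free_cycle_9:
  "free_cycle [a, b, c, d, e, f, g, h, i] \<longleftrightarrow>
    distinct [a, b, c, d, e, f, g, h, i] \<and> adj a b \<and> adj b c \<and> adj c d \<and> adj d e \<and> adj e f \<and>
    adj f g \<and> adj g h \<and> adj h i \<and> adj i a \<and>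
    x \<notin> {a, b, c, d, e, f, g, h, i} \<and> y \<notin> {a, b, c, d, e, f, g, h, i}"
  by (auto simp: free_cycle_def cycle_list_def adj_def)

text \<open>By \<open>nb\<close>, the set \<open>S\<close> together with all its neighbours is
  closed under adjacency, so connectedness makes it contain every endpoint.\<close>

lemma free_cycle_spans:
  assumes nb: "\<And>a b s. s \<in> S \<Longrightarrow> adj a s \<Longrightarrow> adj a b \<Longrightarrow> a \<notin> S \<Longrightarrow> b \<notin> S \<Longrightarrow> \<exists>s\<in>S. adj b s"
    and S: "S \<inter> \<Union>E \<noteq> {}" and u: "u \<in> \<Union>E" "u \<notin> S"
  obtains s where "s \<in> S" "adj u s"
proof -
  have "\<Union>E \<subseteq> S \<union> {u. \<exists>s\<in>S. adj u s}"
  proof (rule connected)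
    show "(S \<union> {u. \<exists>s\<in>S. adj u s}) \<inter> \<Union>E \<noteq> {}" using S by blast
    fix a b assume "a \<in> S \<union> {u. \<exists>s\<in>S. adj u s}" "{a, b} \<in> E"
    then show "b \<in> S \<union> {u. \<exists>s\<in>S. adj u s}"
      using nb[of _ a b] adj_sym[of a b] by (fastforce simp: adj_def)
  qed
  then show thesis using u that by blast
qed

text \<open>A maximal matching outside \<open>S\<close> that contains \<open>xy\<close> must saturate \<open>z\<close>.\<close>

lemma third_neighbour:
  assumes S: "solid E S k" and xyz: "x \<notin> S" "y \<notin> S" "z \<notin> S" and s: "s \<in> S" "adj z s"
  obtains c where "adj z c" "c \<notin> S" "c \<noteq> x" "c \<noteq> y"
proof -
  have "matching (del E S) {{x, y}}" using xy xyz by (auto simp: matching_def del_def)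
  then obtain M where M: "{{x, y}} \<subseteq> M" "maximal_matching (del E S) M"
    using matching_extend[OF edge_set_del[OF E]] by blast
  note M1 = maximal_matching_del[OF M(2)]
  have "{z, s} \<subseteq> S \<union> \<Union>M"
    by (rule solid_closed[OF S M(2)]) (use s in \<open>auto simp: adj_def\<close>)
  then obtain f where f: "f \<in> M" "z \<in> f" using xyz by blast
  have fE: "f \<in> E" using f M1(1) matching_subset by blast
  obtain c where c: "f = {z, c}" by (rule edge_other[OF E fE f(2)])
  have "x \<noteq> z" "y \<noteq> z" using edge_neq[OF E xz] edge_neq[OF E yz] by auto
  then have "f \<noteq> {x, y}" using f(2) by auto
  then have "x \<notin> f" "y \<notin> f"
    using matching_disjoint[OF M1(1) f(1), of "{x, y}"] M(1) by blast+
  moreover have "c \<notin> S" using M1(2) f(1) c by blast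
  ultimately show thesis using that[of c] c fE unfolding adj_def by blast
qed

text \<open>Matching \<open>v2\<close> with \<open>v3\<close> leaves \<open>v1\<close> and
  \<open>v4\<close>; these are not adjacent, since with \<open>v0\<close> they would form a triangle
  without \<open>x\<close>.\<close>

lemma five_neighbour:
  assumes c: "free_cycle [v0, v1, v2, v3, v4]"
    and ab: "adj a v0" "adj a b" "a \<notin> {v0, v1, v2, v3, v4}" "b \<notin> {v0, v1, v2, v3, v4}"
  shows "adj b v1 \<or> adj b v4"
proof (rule free_cycle_neighbour[OF c _ _ ab(1,2), where N = "{{v2, v3}}"])
  show "matching E {{v2, v3}}" using c by (auto simp: free_cycle_5 intro: matching_single)
  show "\<not> adj v1 v4"
  proof
    assume "adj v1 v4"
    then have "x \<in> {v0, v1, v4}" using no_triangle(1)[of v0 v1 v4] c adj_sym by (auto simp: free_cycle_5)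
    then show False using c by (auto simp: free_cycle_5)
  qed
qed (use c ab in \<open>auto simp: free_cycle_5\<close>)

text \<open>Applied to \<open>x\<close> and its neighbour \<open>y\<close>, the preceding lemma
  joins \<open>y\<close> to a cycle neighbour of \<open>z\<close>. That vertex, \<open>y\<close> and
  \<open>z\<close> would form a triangle without \<open>x\<close>.\<close>

lemma no_free_five_through_z: "\<not> free_cycle [z, v1, v2, v3, v4]"
proof
  assume c: "free_cycle [z, v1, v2, v3, v4]"
  have "adj y v1 \<or> adj y v4"
    using five_neighbour[OF c, of x y] c xy xz by (auto simp: free_cycle_5 adj_def)
  moreover have "adj z v1" "adj z v4" using c adj_sym by (auto simp: free_cycle_5)
  moreover have "adj y z" using yz by (simp add: adj_def)
  ultimately show False
    using no_triangle(1)[of y v1 z] no_triangle(1)[of y v4 z] c adj_sym edge_neq[OF E xy] edge_neq[OF E xz]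
    by (auto simp: free_cycle_5)
qed

lemma free_cycle_5_rotate: "free_cycle [a, b, c, d, e] \<Longrightarrow> free_cycle [b, c, d, e, a]"
  by (auto simp: free_cycle_5)

lemma free_cycle_5_rev: "free_cycle [a, b, c, d, e] \<Longrightarrow> free_cycle [a, e, d, c, b]"
  by (auto simp: free_cycle_5 adj_sym)

text \<open>The path \<open>v0\<close>, \<open>z\<close>, \<open>w\<close>, \<open>v1\<close>
  replaces an edge and lengthens the cycle to seven vertices. Matching \<open>v1v2\<close> and
  \<open>v4v0\<close> leaves \<open>w\<close> and \<open>v3\<close>, which are not adjacent because
  \<open>[z, w, v3, v4, v0]\<close> would be a five-cycle through \<open>z\<close>. So
  \<open>q\<close> is adjacent to \<open>w\<close> or \<open>v3\<close>, which gives a triangle with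
  \<open>z\<close> or with \<open>v4\<close> that avoids \<open>p\<close>.\<close>

lemma no_free_five_aux:
  assumes c: "free_cycle [v0, v1, v2, v3, v4]" and zn: "z \<notin> {v0, v1, v2, v3, v4}"
    and pq: "apex_pair p q" and z0: "adj z v0"
    and q: "adj q v4"
    and w: "adj z w" "w \<notin> {v0, v1, v2, v3, v4}" "w \<noteq> x" "w \<noteq> y" "adj w v1"
  shows False
proof -
  have wpq: "w \<noteq> p" "w \<noteq> q" "p \<notin> {v0, v1, v2, v3, v4}" "q \<notin> {v0, v1, v2, v3, v4}"
    using pq w c by (auto simp: apex_pair_cases free_cycle_5)
  have zpq: "z \<noteq> x" "z \<noteq> y" "p \<noteq> q" "z \<noteq> p" "z \<noteq> q"
    using edge_neq[OF E xz] edge_neq[OF E yz] apex_pair_adj[OF pq] adj_neq by auto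
  have w3: "\<not> adj w v3"
  proof
    assume "adj w v3"
    then have "free_cycle [z, w, v3, v4, v0]"
      using c w z0 zn zpq adj_neq[OF w(1)] adj_sym[OF z0] by (auto simp: free_cycle_5)
    then show False using no_free_five_through_z by blast
  qed
  have c7: "free_cycle [z, w, v1, v2, v3, v4, v0]"
    using c w z0 zn zpq adj_neq[OF w(1)] adj_sym[OF z0] by (auto simp: free_cycle_5 free_cycle_7)
  have "adj q w \<or> adj q v3"
  proof (rule free_cycle_neighbour[OF c7, where s = z and a = p and N = "{{v1, v2}, {v4, v0}}"])
    show "matching E {{v1, v2}, {v4, v0}}"
      using c by (intro matching_two) (auto simp: free_cycle_5)
    have "{v1, v2} \<noteq> {v4, v0}" using c by (auto simp: free_cycle_5 doubleton_eq_iff)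
    then show "Suc (card {{v1, v2}, {v4, v0}}) = length [z, w, v1, v2, v3, v4, v0] div 2" by simp
    show "adj p z" "adj p q" using apex_pair_adj[OF pq] by auto
  qed (use c7 w3 wpq zpq in \<open>auto simp: free_cycle_7\<close>)
  then show False
  proof
    assume "adj q w"
    then show False
      using no_triangle_apex[OF pq, of q w z] w(1) adj_sym apex_pair_adj[OF pq] wpq zpq by auto
  next
    assume "adj q v3"
    then show False
      using no_triangle_apex[OF pq, of q v3 v4] q c wpq zpq by (auto simp: free_cycle_5)
  qed
qed

lemma free_cycle_in_Union: "free_cycle (a # xs) \<Longrightarrow> set (a # xs) \<inter> \<Union>E \<noteq> {}"
  by (cases xs) (auto simp: free_cycle_def cycle_list_def)

lemma z_in: "z \<in> \<Union>E"
  using xz by blast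

text \<open>Both \<open>x\<close> and \<open>y\<close> are adjacent to \<open>v1\<close> or
  \<open>v4\<close>, but not to the same one, as that triangle would miss \<open>z\<close>; so each
  of \<open>v1\<close>, \<open>v4\<close> gets one of them. A further neighbour \<open>w\<close> of
  \<open>z\<close> also reaches \<open>v1\<close> or \<open>v4\<close>, and reversing the cycle
  exchanges these two cases.\<close>

lemma no_free_five_adj:
  assumes c: "free_cycle [v0, v1, v2, v3, v4]" and zn: "z \<notin> {v0, v1, v2, v3, v4}"
    and z0: "adj z v0"
  shows False
proof -
  have xy': "x \<notin> {v0, v1, v2, v3, v4}" "y \<notin> {v0, v1, v2, v3, v4}" using c by (auto simp: free_cycle_5)
  have "\<exists>p q. apex_pair p q \<and> adj p v1 \<and> adj q v4"
  proof -
    have 1: "adj x v1 \<or> adj x v4" "adj y v1 \<or> adj y v4"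
      using five_neighbour[OF c z0 _ zn] xy' apex_pair_adj[of x y] by (auto simp: apex_pair_def)
    have "\<not> (adj x v \<and> adj y v)" if "v \<in> {v1, v4}" for v
      using no_triangle(3)[of x v y] adj_sym that zn xy edge_neq[OF E xz] edge_neq[OF E yz]
      by (auto simp: adj_def)
    then show ?thesis using 1 unfolding apex_pair_cases by blast
  qed
  then obtain p q where pq: "apex_pair p q" and p1: "adj p v1" and q4: "adj q v4" by blast
  have s: "solid E {v0, v1, v2, v3, v4} 2" using solid_free_cycle[OF c, of 2] by simp
  obtain w where w: "adj z w" "w \<notin> {v0, v1, v2, v3, v4}" "w \<noteq> x" "w \<noteq> y"
    using third_neighbour[OF s xy' zn _ z0] by blast
  have "adj w v1 \<or> adj w v4" by (rule five_neighbour[OF c z0 w(1) zn w(2)])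
  then show False
  proof
    assume "adj w v1"
    then show False using no_free_five_aux[OF c zn pq z0 q4 w] by blast
  next
    assume "adj w v4"
    then show False
      using no_free_five_aux[OF free_cycle_5_rev[OF c] _ apex_pair_sym[OF pq] z0 p1 w(1) _ w(3,4)]
        zn w(2) by auto
  qed
qed

text \<open>By \<open>five_neighbour\<close>, outside vertices adjacent to the cycle pass this
  property on to their outside neighbours. So connectedness makes \<open>z\<close> adjacent to the
  cycle, and a rotation puts the contact at \<open>v0\<close>.\<close>

lemma no_free_five: "\<not> free_cycle [v0, v1, v2, v3, v4]"
proof
  assume c: "free_cycle [v0, v1, v2, v3, v4]"
  note c1 = free_cycle_5_rotate[OF c]
  note c2 = free_cycle_5_rotate[OF c1]
  note c3 = free_cycle_5_rotate[OF c2]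
  note c4 = free_cycle_5_rotate[OF c3]
  let ?S = "{v0, v1, v2, v3, v4}"
  have zn: "z \<notin> ?S"
    using no_free_five_through_z c c1 c2 c3 c4 by blast
  have nb: "\<exists>s\<in>?S. adj b s" if "s \<in> ?S" "adj a s" "adj a b" "a \<notin> ?S" "b \<notin> ?S" for a b s
    using that five_neighbour[OF c, of a b] five_neighbour[OF c1, of a b] five_neighbour[OF c2, of a b]
      five_neighbour[OF c3, of a b] five_neighbour[OF c4, of a b] by auto
  have ne: "?S \<inter> \<Union>E \<noteq> {}" using free_cycle_in_Union[OF c] unfolding list.set .
  obtain s where s: "s \<in> ?S" "adj z s"
    by (rule free_cycle_spans[OF nb ne z_in zn])
  have "\<not> adj z v0" using no_free_five_adj[OF c zn] by blast
  moreover have "\<not> adj z v1" using no_free_five_adj[OF c1] zn by auto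
  moreover have "\<not> adj z v2" using no_free_five_adj[OF c2] zn by auto
  moreover have "\<not> adj z v3" using no_free_five_adj[OF c3] zn by auto
  moreover have "\<not> adj z v4" using no_free_five_adj[OF c4] zn by auto
  ultimately show False using s by auto
qed

section \<open>Cycles of length seven\<close>

lemma free_cycle_7_rotate: "free_cycle [a, b, c, d, e, f, g] \<Longrightarrow> free_cycle [b, c, d, e, f, g, a]"
  by (auto simp: free_cycle_7)

lemma free_cycle_7_rev: "free_cycle [a, b, c, d, e, f, g] \<Longrightarrow> free_cycle [a, g, f, e, d, c, b]"
  by (auto simp: free_cycle_7 adj_sym)

text \<open>Matching \<open>v1v2\<close> and \<open>v4v5\<close> leaves \<open>v3\<close> and
  \<open>v6\<close>, and an edge between them would close the five-cycle
  \<open>[v3, v6, v0, v1, v2]\<close>. The reversed cycle gives a second condition, with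
  \<open>v4\<close> and \<open>v1\<close>.\<close>

lemma seven_neighbour:
  assumes c: "free_cycle [v0, v1, v2, v3, v4, v5, v6]"
    and ab: "adj a v0" "adj a b" "a \<notin> {v0, v1, v2, v3, v4, v5, v6}" "b \<notin> {v0, v1, v2, v3, v4, v5, v6}"
  shows "adj b v3 \<or> adj b v6"
proof (rule free_cycle_neighbour[OF c _ _ ab(1,2), where N = "{{v1, v2}, {v4, v5}}"])
  show "matching E {{v1, v2}, {v4, v5}}"
    using c by (intro matching_two) (auto simp: free_cycle_7)
  have "{v1, v2} \<noteq> {v4, v5}" using c by (auto simp: free_cycle_7 doubleton_eq_iff)
  then show "Suc (card {{v1, v2}, {v4, v5}}) = length [v0, v1, v2, v3, v4, v5, v6] div 2" by simp
  show "\<not> adj v3 v6"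
  proof
    assume "adj v3 v6"
    then have "free_cycle [v3, v6, v0, v1, v2]" using c by (auto simp: free_cycle_7 free_cycle_5)
    then show False using no_free_five by blast
  qed
qed (use c ab in \<open>auto simp: free_cycle_7\<close>)

text \<open>The two conditions give \<open>y\<close> a neighbour among \<open>v3\<close>,
  \<open>v6\<close> and one among \<open>v4\<close>, \<open>v1\<close>. The neighbours
  \<open>v1\<close> and \<open>v6\<close> of \<open>z\<close> would make a triangle with
  \<open>y\<close> and \<open>z\<close>, and \<open>v3\<close> with \<open>v4\<close> one with
  \<open>y\<close>; each misses \<open>x\<close>.\<close>

lemma no_free_seven_through_z: "\<not> free_cycle [z, v1, v2, v3, v4, v5, v6]"
proof
  assume c: "free_cycle [z, v1, v2, v3, v4, v5, v6]"
  have "adj y v3 \<or> adj y v6" "adj y v4 \<or> adj y v1"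
    using seven_neighbour[OF c, of x y] seven_neighbour[OF free_cycle_7_rev[OF c], of x y] c xy xz
    by (auto simp: free_cycle_7 adj_def)
  moreover have "adj z v1" "adj z v6" "adj v3 v4" using c adj_sym by (auto simp: free_cycle_7)
  moreover have "adj y z" using yz by (simp add: adj_def)
  ultimately show False
    using no_triangle(1)[of y v1 z] no_triangle(1)[of y v6 z] no_triangle(1)[of y v3 v4] c adj_sym
      edge_neq[OF E xy] edge_neq[OF E xz]
    by (auto simp: free_cycle_7)
qed

text \<open>As for five vertices, one step longer: the cycle through \<open>z\<close> and
  \<open>w\<close> has nine vertices, three matching edges leave \<open>w\<close> and
  \<open>v3\<close>, and the edge \<open>wv3\<close> would close a seven-cycle through
  \<open>z\<close>.\<close>

lemma no_free_seven_aux: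
  assumes c: "free_cycle [v0, v1, v2, v3, v4, v5, v6]" and zn: "z \<notin> {v0, v1, v2, v3, v4, v5, v6}"
    and pq: "apex_pair p q" and z0: "adj z v0" and q: "adj q v4"
    and w: "adj z w" "w \<notin> {v0, v1, v2, v3, v4, v5, v6}" "w \<noteq> x" "w \<noteq> y" "adj w v1"
  shows False
proof -
  let ?C = "[z, w, v1, v2, v3, v4, v5, v6, v0]"
  have wpq: "w \<noteq> p" "w \<noteq> q" "p \<notin> {v0, v1, v2, v3, v4, v5, v6}" "q \<notin> {v0, v1, v2, v3, v4, v5, v6}"
    using pq w c by (auto simp: apex_pair_cases free_cycle_7)
  have zpq: "z \<noteq> x" "z \<noteq> y" "p \<noteq> q" "z \<noteq> p" "z \<noteq> q"
    using edge_neq[OF E xz] edge_neq[OF E yz] apex_pair_adj[OF pq] adj_neq by auto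
  have w3: "\<not> adj w v3"
  proof
    assume "adj w v3"
    then have "free_cycle [z, w, v3, v4, v5, v6, v0]"
      using c w z0 zn zpq adj_neq[OF w(1)] adj_sym[OF z0] by (auto simp: free_cycle_7)
    then show False using no_free_seven_through_z by blast
  qed
  have c9: "free_cycle ?C"
    using c w z0 zn zpq adj_neq[OF w(1)] adj_sym[OF z0] by (auto simp: free_cycle_7 free_cycle_9)
  have "adj q w \<or> adj q v3"
  proof (rule free_cycle_neighbour[OF c9, where s = z and a = p and N = "{{v1, v2}, {v4, v5}, {v6, v0}}"])
    show "matching E {{v1, v2}, {v4, v5}, {v6, v0}}"
      using c by (intro matching_three) (auto simp: free_cycle_7)
    have "{v1, v2} \<noteq> {v4, v5}" "{v1, v2} \<noteq> {v6, v0}" "{v4, v5} \<noteq> {v6, v0}"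
      using c by (auto simp: free_cycle_7 doubleton_eq_iff)
    then show "Suc (card {{v1, v2}, {v4, v5}, {v6, v0}}) = length ?C div 2" by simp
    show "adj p z" "adj p q" using apex_pair_adj[OF pq] by auto
  qed (use c9 w3 wpq zpq in \<open>auto simp: free_cycle_9\<close>)
  then show False
  proof
    assume "adj q w"
    then show False
      using no_triangle_apex[OF pq, of q w z] w(1) adj_sym apex_pair_adj[OF pq] wpq zpq by auto
  next
    assume "adj q v3"
    then show False
      using no_triangle_apex[OF pq, of q v3 v4] q c wpq zpq by (auto simp: free_cycle_7)
  qed
qed

lemma no_free_seven_adj:
  assumes c: "free_cycle [v0, v1, v2, v3, v4, v5, v6]" and zn: "z \<notin> {v0, v1, v2, v3, v4, v5, v6}"
    and z0: "adj z v0"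
  shows False
proof -
  let ?S = "{v0, v1, v2, v3, v4, v5, v6}"
  have xy': "x \<notin> ?S" "y \<notin> ?S" using c by (auto simp: free_cycle_7)
  have nb: "(adj b v3 \<or> adj b v6) \<and> (adj b v4 \<or> adj b v1)" if "adj z b" "b \<notin> ?S" for b
    using seven_neighbour[OF c z0 that(1) zn that(2)] seven_neighbour[OF free_cycle_7_rev[OF c] z0 that(1)]
      zn that(2) by auto
  have 34: "\<not> (adj b v3 \<and> adj b v4)" if "b = x \<or> b = y" for b
    using no_triangle(1)[of b v3 v4] no_triangle(2)[of b v3 v4] that c edge_neq[OF E xy]
    by (auto simp: free_cycle_7)
  have xyS: "\<not> (adj x v \<and> adj y v)" if "v \<in> ?S" for v
    using no_triangle(3)[of x v y] adj_sym that zn xy edge_neq[OF E xz] edge_neq[OF E yz]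
    by (auto simp: adj_def)
  have "adj z x" "adj z y" using xz yz by (auto simp: adj_def insert_commute)
  \<comment> \<open>Neither of \<open>x\<close>, \<open>y\<close> is adjacent to both
    \<open>v3\<close> and \<open>v4\<close>, and they share no neighbour on the cycle. Hence one of
    them takes \<open>v1\<close> and \<open>v3\<close>, the other \<open>v4\<close> and
    \<open>v6\<close>.\<close>
  then obtain p q where pq: "apex_pair p q" and p3: "adj p v3" and q4: "adj q v4"
    using nb[of x] nb[of y] xy' 34[of x] 34[of y] xyS[of v1] xyS[of v6] xyS[of v3] xyS[of v4]
    unfolding apex_pair_cases by auto
  have s: "solid E ?S 3" using solid_free_cycle[OF c, of 3] by simp
  obtain w where w: "adj z w" "w \<notin> ?S" "w \<noteq> x" "w \<noteq> y"
    using third_neighbour[OF s xy' zn _ z0] by blast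
  consider "adj w v1" | "adj w v6" | "adj w v3" "adj w v4" using nb[OF w(1,2)] by blast
  then show False
  proof cases
    case 1
    then show False using no_free_seven_aux[OF c zn pq z0 q4 w] by blast
  next
    case 2
    then show False
      using no_free_seven_aux[OF free_cycle_7_rev[OF c] _ apex_pair_sym[OF pq] z0 p3 w(1) _ w(3,4)]
        zn w(2) by auto
  next
    case 3
    then show False using no_triangle(1)[of w v3 v4] c w by (auto simp: free_cycle_7)
  qed
qed

lemma no_free_seven: "\<not> free_cycle [v0, v1, v2, v3, v4, v5, v6]"
proof
  assume c: "free_cycle [v0, v1, v2, v3, v4, v5, v6]"
  note c1 = free_cycle_7_rotate[OF c]
  note c2 = free_cycle_7_rotate[OF c1]
  note c3 = free_cycle_7_rotate[OF c2]
  note c4 = free_cycle_7_rotate[OF c3]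
  note c5 = free_cycle_7_rotate[OF c4]
  note c6 = free_cycle_7_rotate[OF c5]
  let ?S = "{v0, v1, v2, v3, v4, v5, v6}"
  have zn: "z \<notin> ?S"
    using no_free_seven_through_z c c1 c2 c3 c4 c5 c6 by blast
  have nb: "\<exists>s\<in>?S. adj b s" if "s \<in> ?S" "adj a s" "adj a b" "a \<notin> ?S" "b \<notin> ?S" for a b s
    using that seven_neighbour[OF c, of a b] seven_neighbour[OF c1, of a b] seven_neighbour[OF c2, of a b]
      seven_neighbour[OF c3, of a b] seven_neighbour[OF c4, of a b] seven_neighbour[OF c5, of a b]
      seven_neighbour[OF c6, of a b] by auto
  have ne: "?S \<inter> \<Union>E \<noteq> {}" using free_cycle_in_Union[OF c] unfolding list.set .
  obtain s where s: "s \<in> ?S" "adj z s"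
    by (rule free_cycle_spans[OF nb ne z_in zn])
  have "\<not> adj z v0" using no_free_seven_adj[OF c zn] by blast
  moreover have "\<not> adj z v1" using no_free_seven_adj[OF c1] zn by auto
  moreover have "\<not> adj z v2" using no_free_seven_adj[OF c2] zn by auto
  moreover have "\<not> adj z v3" using no_free_seven_adj[OF c3] zn by auto
  moreover have "\<not> adj z v4" using no_free_seven_adj[OF c4] zn by auto
  moreover have "\<not> adj z v5" using no_free_seven_adj[OF c5] zn by auto
  moreover have "\<not> adj z v6" using no_free_seven_adj[OF c6] zn by auto
  ultimately show False using s by auto
qed

section \<open>Odd closed walks that avoid \<open>x\<close> and \<open>y\<close>\<close>

definition rest_rel :: "('a \<times> 'a) set" where
  "rest_rel = {(u, v). {u, v} \<in> del E {x, y}}"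

lemma rest_relD: "(u, v) \<in> rest_rel \<Longrightarrow> adj u v \<and> u \<noteq> x \<and> u \<noteq> y \<and> v \<noteq> x \<and> v \<noteq> y"
  by (auto simp: rest_rel_def del_def adj_def)

lemma rest_relI: "adj u v \<Longrightarrow> u \<noteq> x \<Longrightarrow> u \<noteq> y \<Longrightarrow> v \<noteq> x \<Longrightarrow> v \<noteq> y \<Longrightarrow> (u, v) \<in> rest_rel"
  by (auto simp: rest_rel_def del_def adj_def)

lemma sym_rest_rel: "sym rest_rel"
  by (auto simp: rest_rel_def sym_def insert_commute)

text \<open>A shortest odd closed walk is a cycle without chords. Length one is a loop and length
  three a triangle without \<open>x\<close>; five and seven are excluded above; from nine on,
  \<open>solid_odd_cycle_chord\<close> produces a chord.\<close>

lemma no_odd_closed_walk: "(u, u) \<in> rest_rel ^^ m \<Longrightarrow> even m"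
proof (rule ccontr)
  assume "(u, u) \<in> rest_rel ^^ m" "odd m"
  then obtain n f where n: "odd n" "\<And>i. i < n \<Longrightarrow> (f i, f (Suc i)) \<in> rest_rel" "f n = f 0" "inj_on f {..<n}"
    and ch: "\<And>i j. i < j \<Longrightarrow> j < n \<Longrightarrow> (f i, f j) \<in> rest_rel \<Longrightarrow> j = Suc i \<or> i = 0 \<and> Suc j = n"
    using shortest_odd_closed_walk[OF sym_rest_rel] by metis
  obtain k where k: "n = 2 * k + 1" using n(1) by (elim oddE)
  have step: "adj (f i) (f (Suc i))" "f i \<noteq> x" "f i \<noteq> y" if "i < n" for i
    using rest_relD[OF n(2)[OF that]] by auto
  have neq: "f i \<noteq> f j" if "i < j" "j < n" for i j
    using inj_onD[OF n(4), of i j] that by auto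
  consider "k = 0" | "k = 1" | "k = 2" | "k = 3" | "4 \<le> k" by linarith
  then show False
  proof cases
    case 1
    then show False using step(1)[of 0] n(3) k adj_neq[of "f 0" "f 0"] by simp
  next
    case 2
    have "f 3 = f 0" using n(3) k 2 by simp
    then have "adj (f 0) (f 1)" "adj (f 1) (f 2)" "adj (f 0) (f 2)"
      using step(1)[of 0] step(1)[of 1] step(1)[of 2] k 2 adj_sym
      by (simp_all add: numeral_2_eq_2 numeral_3_eq_3)
    then show False using no_triangle(1)[of "f 0" "f 1" "f 2"] step(2)[of 0] step(2)[of 1] step(2)[of 2] k 2
      by simp
  next
    case 3
    then have "n = 5" using k by simp
    then have "free_cycle [f 0, f 1, f 2, f 3, f 4]"
      using step(1)[of 0] step(1)[of 1] step(1)[of 2] step(1)[of 3] step(1)[of 4] n(3)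
        neq[of 0 1] neq[of 0 2] neq[of 0 3] neq[of 0 4] neq[of 1 2] neq[of 1 3] neq[of 1 4]
        neq[of 2 3] neq[of 2 4] neq[of 3 4]
        step(2)[of 0] step(2)[of 1] step(2)[of 2] step(2)[of 3] step(2)[of 4]
        step(3)[of 0] step(3)[of 1] step(3)[of 2] step(3)[of 3] step(3)[of 4]
      by (simp add: free_cycle_5 eval_nat_numeral)
    then show False using no_free_five by blast
  next
    case 4
    then have "n = 7" using k by simp
    then have "free_cycle [f 0, f 1, f 2, f 3, f 4, f 5, f 6]"
      using step(1)[of 0] step(1)[of 1] step(1)[of 2] step(1)[of 3] step(1)[of 4] step(1)[of 5] step(1)[of 6] n(3)
        neq[of 0 1] neq[of 0 2] neq[of 0 3] neq[of 0 4] neq[of 0 5] neq[of 0 6]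
        neq[of 1 2] neq[of 1 3] neq[of 1 4] neq[of 1 5] neq[of 1 6]
        neq[of 2 3] neq[of 2 4] neq[of 2 5] neq[of 2 6]
        neq[of 3 4] neq[of 3 5] neq[of 3 6] neq[of 4 5] neq[of 4 6] neq[of 5 6]
        step(2)[of 0] step(2)[of 1] step(2)[of 2] step(2)[of 3] step(2)[of 4] step(2)[of 5] step(2)[of 6]
        step(3)[of 0] step(3)[of 1] step(3)[of 2] step(3)[of 3] step(3)[of 4] step(3)[of 5] step(3)[of 6]
      by (simp add: free_cycle_7 eval_nat_numeral)
    then show False using no_free_seven by blast
  next
    case 5
    have c: "odd_cycle E k (\<lambda>i. f (i mod (2 * k + 1)))"
    proof (rule odd_cycleI)
      show "inj_on f {..2 * k}" using n(4) k by (simp add: lessThan_Suc_atMost)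
      show "{f i, f (Suc i)} \<in> E" if "i < 2 * k" for i using step(1)[of i] that k by (simp add: adj_def)
      show "{f (2 * k), f 0} \<in> E" using step(1)[of "2 * k"] n(3) k by (simp add: adj_def)
    qed
    have lt: "i mod (2 * k + 1) < n" for i using k by simp
    have "solid E (range (\<lambda>i. f (i mod (2 * k + 1)))) k"
      by (rule solid_free_odd_cycle[OF c]) (use 5 step(2,3)[OF lt] in auto)
    from solid_odd_cycle_chord[OF E wed c this 5]
    have "adj (f 2) (f 5) \<or> adj (f 2) (f 8) \<or> adj (f 5) (f 8)" using 5 by (simp add: adj_def)
    then have "(f 2, f 5) \<in> rest_rel \<or> (f 2, f 8) \<in> rest_rel \<or> (f 5, f 8) \<in> rest_rel"
      using step(2,3)[of 2] step(2,3)[of 5] step(2,3)[of 8] k 5 rest_relI by auto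
    then show False using ch[of 2 5] ch[of 2 8] ch[of 5 8] k 5 by auto
  qed
qed

end

section \<open>Maximal matchings of bipartite graphs\<close>

lemma maximal_matching_meets: "maximal_matching E M \<Longrightarrow> e \<in> E \<Longrightarrow> e \<inter> \<Union>M \<noteq> {}"
  unfolding maximal_matching_def by blast

lemma nu_del_le:
  assumes "edge_set E" "wed E" "wed (del E S)"
  shows "nu (del E S) \<le> nu E"
proof -
  obtain M where M: "maximal_matching (del E S) M"
    using maximal_matching_ex[OF edge_set_del[OF assms(1)]] by blast
  then have "matching E M" by (auto simp: maximal_matching_def matching_def del_def)
  then show ?thesis
    using card_matching_le[OF assms(1,2)] card_maximal_matching[OF edge_set_del[OF assms(1)] assms(3) M]
    by metis
qed

lemma matching_insert_all:
  assumes "edge_set E" "matching E M" "e \<in> E" "e \<inter> \<Union>M = {}"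
  shows "matching E (insert e M)" "card (insert e M) = Suc (card M)" "\<Union>(insert e M) = e \<union> \<Union>M"
  using matching_insert[OF assms(2-4)] card_matching_insert[OF assms] by auto

lemma matching_remove:
  assumes "edge_set E" "matching E M" "e \<in> M"
  shows "matching E (M - {e})" "card M = Suc (card (M - {e}))" "\<Union>(M - {e}) = \<Union>M - e"
  using matching_sub[OF assms(2)] Union_matching_remove[OF assms(2,3)]
    card_Suc_Diff1[OF finite_matching[OF assms(1,2)] assms(3)] by auto

text \<open>Being missed together with \<open>a\<close> is carried from \<open>b\<close> to
  \<open>v\<close>, two steps along a walk. If \<open>u\<close> is matched to \<open>v\<close>, it
  is rematched to \<open>b\<close>. Otherwise let \<open>b'\<close> and \<open>q\<close> be the
  partners of \<open>u\<close> and \<open>v\<close>; the free edge that appears when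
  \<open>ub'\<close> and \<open>vq\<close> are exchanged for \<open>uv\<close> shows how to release
  \<open>v\<close>.\<close>

lemma maximal_matching_missing_step:
  assumes E: "edge_set E" and w: "wed E"
    and bip: "\<And>e. e \<in> E \<Longrightarrow> \<exists>a\<in>A. \<exists>b\<in>B. e = {a, b}" and AB: "A \<inter> B = {}"
    and M: "maximal_matching E M" and a: "a \<in> A" "a \<notin> \<Union>M" and b: "b \<in> B" "b \<notin> \<Union>M"
    and uv: "{u, b} \<in> E" "{u, v} \<in> E" "u \<in> A" "v \<in> B"
  obtains M' where "maximal_matching E M'" "a \<notin> \<Union>M'" "v \<notin> \<Union>M'"
proof (cases "v \<in> \<Union>M")
  case False
  then show thesis using that M a(2) by blast
next
  case True
  note M1 = maximal_matchingD[OF M]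
  have nuE: "card M = nu E" by (rule card_maximal_matching[OF E w M])
  have maxI: "maximal_matching E N" if "matching E N" "card N = card M" for N
    using maximal_matchingI_card[OF E w that(1)] that(2) nuE by simp
  have side: "t \<in> B" if "{s, t} \<in> E" "s \<in> A" for s t
    using bip[OF that(1)] AB that(2) by (auto simp: doubleton_eq_iff)
  have side': "t \<in> A" if "{s, t} \<in> E" "s \<in> B" for s t
    using bip[OF that(1)] AB that(2) by (auto simp: doubleton_eq_iff)
  have "{u, b} \<inter> \<Union>M \<noteq> {}" by (rule maximal_matching_meets[OF M uv(1)])
  then obtain f where f: "f \<in> M" "u \<in> f" using b(2) by blast
  have fE: "f \<in> E" using f(1) matching_subset[OF M1] by blast
  obtain b' where b': "f = {u, b'}" by (rule edge_other[OF E fE f(2)])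
  have b'B: "b' \<in> B" using side fE b' uv(3) by blast
  note K1 = matching_remove[OF E M1 f(1)]
  have bM: "b \<noteq> b'" using b(2) f(1) b' by blast
  have ua: "a \<noteq> u" using a(2) f by blast
  have ub: "u \<noteq> b" "a \<noteq> b" "a \<noteq> v" "u \<noteq> v" "u \<noteq> b'" using AB uv(3,4) b(1) a(1) b'B by auto
  have d: "{u, b} \<inter> \<Union>(M - {f}) = {}" using K1(3) b(2) b' by auto
  note N1 = matching_insert_all[OF E K1(1) uv(1) d]
  show thesis
  proof (cases "b' = v")
    case True
    have "maximal_matching E (insert {u, b} (M - {f}))" by (rule maxI[OF N1(1)]) (use N1(2) K1(2) in simp)
    moreover have "a \<notin> \<Union>(insert {u, b} (M - {f}))" "v \<notin> \<Union>(insert {u, b} (M - {f}))"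
      unfolding N1(3) K1(3) using a ua ub bM True b' by auto
    ultimately show thesis using that by blast
  next
    case ne: False
    obtain g where g: "g \<in> M" "v \<in> g" using True by blast
    have gE: "g \<in> E" using g(1) matching_subset[OF M1] by blast
    obtain q where q: "g = {v, q}" by (rule edge_other[OF E gE g(2)])
    have qA: "q \<in> A" using side' gE q uv(4) by blast
    have gf: "g \<noteq> f" using g(2) b' ne ub by auto
    then have gM: "g \<in> M - {f}" using g by blast
    have fg: "f \<inter> g = {}" using matching_disjoint[OF M1 f(1) g(1)] gf by blast
    have qneq: "q \<noteq> u" "q \<noteq> b'" "q \<noteq> a" "q \<noteq> b" "q \<noteq> v"
      using fg b' q a(2) g(1) b(2) AB qA uv(4) by auto
    note K = matching_remove[OF E K1(1) gM]
    define K' where "K' = M - {f} - {g}"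
    note K = K[folded K'_def]
    have "\<Union>K' = \<Union>M - f - g" using K(3) K1(3) by argo
    then have UK: "\<Union>K' = \<Union>M - {u, b', v, q}" unfolding b' q by blast
    have cK: "card M = Suc (Suc (card K'))" using K(2) K1(2) by simp
    have d: "{u, v} \<inter> \<Union>K' = {}" unfolding UK by auto
    note L = matching_insert_all[OF E K(1) uv(2) d]
    \<comment> \<open>Two edges were traded for one, so a free edge \<open>e\<close> exists;
      maximality of \<open>M\<close> makes it contain \<open>q\<close> or \<open>b'\<close>.\<close>
    have "card (insert {u, v} K') < nu E" using L(2) cK nuE by simp
    then obtain e where e: "e \<in> E" "e \<inter> \<Union>(insert {u, v} K') = {}"
      by (rule matching_extendable[OF E w L(1)])
    have eK: "e \<inter> (\<Union>M - {b', q}) = {}" "u \<notin> e" "v \<notin> e"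
      using e(2) unfolding L(3) UK by auto
    have "e \<inter> \<Union>M \<noteq> {}" by (rule maximal_matching_meets[OF M e(1)])
    then have "q \<in> e \<or> b' \<in> e" using eK(1) by blast
    then show thesis
    proof (cases "q \<in> e")
      case True
      obtain t where t: "e = {q, t}" "q \<noteq> t" by (rule edge_other[OF E e(1) True])
      have tB: "t \<in> B" using side e(1) t(1) qA by blast
      have tn: "t \<noteq> u" "t \<noteq> v" "t \<noteq> a" using tB uv(3) AB a(1) eK(3) t(1) by auto
      \<comment> \<open>If \<open>t\<close> is \<open>b'\<close>, the edges \<open>ub\<close> and
        \<open>qb'\<close> replace the two removed ones. Otherwise \<open>t\<close> is unmatched:
        \<open>ub'\<close> is kept and \<open>qt\<close> replaces \<open>qv\<close>.\<close>
      show thesis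
      proof (cases "t = b'")
        case True
        have d: "{u, b} \<inter> \<Union>K' = {}" unfolding UK using b(2) by auto
        note P = matching_insert_all[OF E K(1) uv(1) d]
        have d: "e \<inter> \<Union>(insert {u, b} K') = {}"
          unfolding P(3) UK unfolding t True using qneq bM ub by auto
        note Q = matching_insert_all[OF E P(1) e(1) d]
        have "maximal_matching E (insert e (insert {u, b} K'))"
          by (rule maxI[OF Q(1)]) (use Q(2) P(2) cK in simp)
        moreover have "a \<notin> \<Union>(insert e (insert {u, b} K'))" "v \<notin> \<Union>(insert e (insert {u, b} K'))"
          unfolding Q(3) P(3) UK unfolding t using a ua ub qneq tn b(2) g by auto
        ultimately show thesis using that by blast
      next
        case False
        have tM: "t \<notin> \<Union>M" using eK(1) t False by auto
        have d: "f \<inter> \<Union>K' = {}" unfolding UK unfolding b' by auto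
        note P = matching_insert_all[OF E K(1) fE d]
        have d: "e \<inter> \<Union>(insert f K') = {}"
          unfolding P(3) UK unfolding t b' using qneq tM tn False by auto
        note Q = matching_insert_all[OF E P(1) e(1) d]
        have "maximal_matching E (insert e (insert f K'))"
          by (rule maxI[OF Q(1)]) (use Q(2) P(2) cK in simp)
        moreover have "a \<notin> \<Union>(insert e (insert f K'))" "v \<notin> \<Union>(insert e (insert f K'))"
          unfolding Q(3) P(3) UK unfolding t b' using a ua ub qneq tn ne f b' by auto
        ultimately show thesis using that by blast
      qed
    next
      case nq: False
      then have "b' \<in> e" using \<open>q \<in> e \<or> b' \<in> e\<close> by blast
      then obtain t where t: "e = {b', t}" "b' \<noteq> t" by (rule edge_other[OF E e(1)])
      have tM: "t \<notin> \<Union>M" using eK(1) t nq by auto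
      have "t \<in> A" using side' e(1) t(1) b'B by blast
      then have "t \<noteq> b" using b(1) AB by auto
      then have d: "e \<inter> \<Union>(insert {u, b} (M - {f})) = {}"
        unfolding N1(3) K1(3) unfolding t b' using tM bM ub eK(2) t by auto
      note P = matching_insert_all[OF E N1(1) e(1) d]
      \<comment> \<open>Here \<open>b\<close>, \<open>u\<close>, \<open>b'\<close>, \<open>t\<close>
        is an augmenting path for \<open>M\<close>.\<close>
      have False using card_matching_le[OF E w P(1)] P(2) N1(2) K1(2) nuE by simp
      then show thesis ..
    qed
  qed
qed

text \<open>If \<open>a\<close> is missed as well as \<open>z\<close>, let \<open>S\<close> collect
  the vertices of \<open>B\<close> that some maximal matching misses together with \<open>a\<close>.
  By the exchange step, \<open>S\<close> with its neighbours is closed under adjacency, so it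
  contains \<open>a\<close>. Then \<open>a\<close> has a neighbour missed together with it, against
  maximality.\<close>

lemma maximal_matching_missing_saturates:
  assumes E: "edge_set E" and w: "wed E"
    and bip: "\<And>e. e \<in> E \<Longrightarrow> \<exists>a\<in>A. \<exists>b\<in>B. e = {a, b}" and AB: "A \<inter> B = {}"
    and conn: "\<And>T. z \<in> T \<Longrightarrow> (\<And>u v. u \<in> T \<Longrightarrow> {u, v} \<in> E \<Longrightarrow> v \<in> T) \<Longrightarrow> A \<subseteq> T"
    and M: "maximal_matching E M" and z: "z \<in> B" "z \<notin> \<Union>M"
  shows "A \<subseteq> \<Union>M"
proof
  fix a assume a: "a \<in> A"
  show "a \<in> \<Union>M"
  proof (rule ccontr)
    assume aM: "a \<notin> \<Union>M"
    define S where "S = {b \<in> B. \<exists>M. maximal_matching E M \<and> a \<notin> \<Union>M \<and> b \<notin> \<Union>M}"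
    have side: "v \<in> B" if "{u, v} \<in> E" "u \<in> A" for u v
      using bip[OF that(1)] AB that(2) by (auto simp: doubleton_eq_iff)
    have side': "v \<in> A" if "{u, v} \<in> E" "u \<in> B" for u v
      using bip[OF that(1)] AB that(2) by (auto simp: doubleton_eq_iff)
    have "A \<subseteq> S \<union> {u. \<exists>b\<in>S. {u, b} \<in> E}"
    proof (rule conn)
      show "z \<in> S \<union> {u. \<exists>b\<in>S. {u, b} \<in> E}" using M z aM by (auto simp: S_def)
      fix u v assume u: "u \<in> S \<union> {u. \<exists>b\<in>S. {u, b} \<in> E}" and uv: "{u, v} \<in> E"
      show "v \<in> S \<union> {u. \<exists>b\<in>S. {u, b} \<in> E}"
      proof (cases "u \<in> S")
        case True
        then show ?thesis using uv by (auto simp: insert_commute)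
      next
        case False
        then obtain b where b: "b \<in> S" "{u, b} \<in> E" using u by blast
        then obtain N where N: "b \<in> B" "maximal_matching E N" "a \<notin> \<Union>N" "b \<notin> \<Union>N"
          unfolding S_def by blast
        have uA: "u \<in> A" using side'[of b u] b(2) N(1) by (simp add: insert_commute)
        have vB: "v \<in> B" by (rule side[OF uv uA])
        obtain N' where "maximal_matching E N'" "a \<notin> \<Union>N'" "v \<notin> \<Union>N'"
          by (rule maximal_matching_missing_step[OF E w bip AB N(2) a N(3,1,4) b(2) uv uA vB])
        then have "v \<in> S" using vB unfolding S_def by blast
        then show ?thesis ..
      qed
    qed
    moreover have "a \<notin> S" using a AB by (auto simp: S_def)
    ultimately obtain b where b: "b \<in> S" "{a, b} \<in> E" using a by blast
    then obtain N where N: "maximal_matching E N" "a \<notin> \<Union>N" "b \<notin> \<Union>N" by (auto simp: S_def)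
    then show False using maximal_matching_meets[OF N(1) b(2)] by blast
  qed
qed

lemma card_less_saturated:
  assumes E: "matching E M" and bip: "\<And>e. e \<in> E \<Longrightarrow> \<exists>a\<in>A. \<exists>b\<in>B. e = {a, b}" and AB: "A \<inter> B = {}"
    and A: "A \<subseteq> \<Union>M" and z: "z \<in> B" "z \<notin> \<Union>M" and B: "finite B"
  shows "card A < card B"
proof -
  have "\<exists>b. b \<in> B \<and> {a, b} \<in> M" if a: "a \<in> A" for a
  proof -
    obtain f where f: "f \<in> M" "a \<in> f" using A a by blast
    then obtain a' b where "a' \<in> A" "b \<in> B" "f = {a', b}" using bip matching_subset[OF E] by blast
    then show ?thesis using f a AB by blast
  qed
  then obtain p where p: "\<And>a. a \<in> A \<Longrightarrow> p a \<in> B \<and> {a, p a} \<in> M" by metis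
  have "inj_on p A"
  proof (rule inj_onI)
    fix a a' assume a: "a \<in> A" "a' \<in> A" "p a = p a'"
    then have "{a, p a} = {a', p a'}"
      using matching_disjoint[OF E, of "{a, p a}" "{a', p a'}" "p a"] p by blast
    then show "a = a'" using a p AB by (auto simp: doubleton_eq_iff)
  qed
  moreover have "p ` A \<subseteq> B - {z}" using p z(2) by blast
  ultimately have "card A \<le> card (B - {z})" using B card_inj_on_le[of p A "B - {z}"] by simp
  then show ?thesis using card_Diff1_less[OF B z(1)] by simp
qed

section \<open>The components left after deleting \<open>x\<close> and \<open>y\<close>\<close>

context unique_triangle
begin

definition comp :: "'a \<Rightarrow> 'a set" where
  "comp u = {v. (u, v) \<in> rest_rel\<^sup>*}"

lemma comp_self: "u \<in> comp u"
  by (simp add: comp_def)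

lemma comp_closed: "a \<in> comp u \<Longrightarrow> (a, b) \<in> rest_rel \<Longrightarrow> b \<in> comp u"
  by (auto simp: comp_def)

lemma comp_sym: "a \<in> comp u \<Longrightarrow> u \<in> comp a"
  using sym_rtrancl[OF sym_rest_rel] by (auto simp: comp_def dest: symD)

lemma comp_eq: "a \<in> comp u \<Longrightarrow> comp a = comp u"
  using comp_sym[of a u] by (auto simp: comp_def)

lemma comp_edge:
  assumes e: "e \<in> del E {x, y}" "e \<inter> comp u \<noteq> {}"
  shows "e \<subseteq> comp u"
proof -
  obtain a where a: "a \<in> e" "a \<in> comp u" using e(2) by blast
  have eE: "e \<in> E" using e(1) by (simp add: del_def)
  obtain b where b: "e = {a, b}" by (rule edge_other[OF E eE a(1)])
  then have "(a, b) \<in> rest_rel" using e(1) by (simp add: rest_rel_def)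
  then show ?thesis using comp_closed a(2) b by auto
qed

definition Hz :: "'a set set" where
  "Hz = {e \<in> del E {x, y}. e \<subseteq> comp z}"

definition Hr :: "'a set set" where
  "Hr = {e \<in> del E {x, y}. e \<inter> comp z = {}}"

lemma del_xy_split: "del E {x, y} = Hz \<union> Hr"
  using comp_edge[of _ z] by (auto simp: Hz_def Hr_def)

lemma Hz_Hr_disjoint: "\<Union>Hz \<inter> \<Union>Hr = {}"
  by (auto simp: Hz_def Hr_def)

lemma Hz_sub: "Hz \<subseteq> E" and Hr_sub: "Hr \<subseteq> E"
  by (auto simp: Hz_def Hr_def del_def)

lemma edge_set_Hz: "edge_set Hz" and edge_set_Hr: "edge_set Hr"
  using edge_set_subset[OF E] Hz_sub Hr_sub by blast+

lemma apex_notin: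
  assumes "apex_pair p q"
  shows "p \<notin> \<Union>Hz" "q \<notin> \<Union>Hz" "p \<notin> \<Union>Hr" "q \<notin> \<Union>Hr"
  using assms by (auto simp: apex_pair_cases Hz_def Hr_def del_def)

lemma z_notin_Hr: "z \<notin> \<Union>Hr"
  using comp_self[of z] by (auto simp: Hr_def)

lemma edge_split: "e \<in> E \<Longrightarrow> apex_pair p q \<Longrightarrow> p \<notin> e \<Longrightarrow> q \<notin> e \<Longrightarrow> e \<in> Hz \<or> e \<in> Hr"
  using del_xy_split by (fastforce simp: apex_pair_cases del_def)

section \<open>Comparing the deletions of different matchings\<close>

lemma nu_xy: "wed Hz" "wed Hr" "nu E = Suc (nu Hz + nu Hr)"
proof -
  have m: "matching E {{x, y}}" using xy by (simp add: matching_def)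
  have U: "wed (Hz \<union> Hr)" "edge_set (Hz \<union> Hr)"
    using wed_del[OF E wed m] edge_set_del[OF E, of "{x, y}"] by (simp_all add: del_xy_split)
  show "wed Hz" "wed Hr"
    using wed_Un1[OF U(2,1) Hz_Hr_disjoint] wed_Un2[OF U(2,1) Hz_Hr_disjoint] by auto
  show "nu E = Suc (nu Hz + nu Hr)"
    using nu_del[OF E wed m] nu_Un[OF U(2,1) Hz_Hr_disjoint] by (simp add: del_xy_split)
qed

text \<open>Deleting \<open>pc\<close> and \<open>qz\<close> costs two edges, deleting
  \<open>xy\<close> one. Comparing the two expressions for \<open>nu E\<close>, the passage to
  \<open>Hz\<close> without \<open>z\<close> and \<open>Hr\<close> without \<open>c\<close> lowers
  the total by exactly one; \<open>nu_del_z\<close> decides which part drops.\<close>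

lemma nu_leg:
  assumes pq: "apex_pair p q" and c: "adj p c" "c \<notin> comp z" "c \<noteq> q"
  shows "wed (del Hz {z})" "wed (del Hr {c})"
    "nu Hz + nu Hr = Suc (nu (del Hz {z}) + nu (del Hr {c}))"
proof -
  have cz: "c \<noteq> z" using c(2) comp_self by auto
  have ne: "{p, c} \<noteq> {q, z}" "{p, c} \<inter> {q, z} = {}"
    using c cz apex_pair_adj[OF pq] adj_neq by auto
  have m: "matching E {{p, c}, {q, z}}"
    using matching_two[OF c(1) apex_pair_adj(3)[OF pq] ne(2)] .
  have "del E {p, c, q, z} = del (del E {x, y}) {c, z}"
    using pq by (auto simp: del_def apex_pair_cases)
  also have "\<dots> = del Hz {z} \<union> del Hr {c}"
    using c(2) comp_self[of z] unfolding del_xy_split by (auto simp: del_def Hz_def Hr_def)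
  finally have eq: "del E {p, c, q, z} = del Hz {z} \<union> del Hr {c}" .
  have U: "wed (del Hz {z} \<union> del Hr {c})" "edge_set (del Hz {z} \<union> del Hr {c})"
    using wed_del[OF E wed m] edge_set_del[OF E, of "{p, c, q, z}"] eq by (simp_all add: insert_commute)
  have d: "\<Union>(del Hz {z}) \<inter> \<Union>(del Hr {c}) = {}" using Hz_Hr_disjoint by (auto simp: del_def)
  show "wed (del Hz {z})" "wed (del Hr {c})"
    using wed_Un1[OF U(2,1) d] wed_Un2[OF U(2,1) d] by auto
  have "nu E = 2 + nu (del E {p, c, q, z})"
    using nu_del[OF E wed m] ne(1) by (simp add: insert_commute)
  then show "nu Hz + nu Hr = Suc (nu (del Hz {z}) + nu (del Hr {c}))"
    using nu_xy(3) eq nu_Un[OF U(2,1) d] by simp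
qed

lemma Union_sub_Hz: "M \<subseteq> Hz \<Longrightarrow> \<Union>M \<subseteq> comp z"
  by (auto simp: Hz_def)

lemma Union_sub_Hr: "M \<subseteq> Hr \<Longrightarrow> \<Union>M \<inter> comp z = {}"
  by (auto simp: Hr_def)

lemma matching_Hz_Hr:
  assumes "matching Hz M" "matching Hr N"
  shows "matching E (M \<union> N)" "card (M \<union> N) = card M + card N"
proof -
  have m: "matching E M" "matching E N"
    using matching_mono[OF assms(1) Hz_sub] matching_mono[OF assms(2) Hr_sub] by auto
  have d: "\<Union>M \<inter> \<Union>N = {}"
    using Union_sub_Hz[OF matching_subset[OF assms(1)]] Union_sub_Hr[OF matching_subset[OF assms(2)]] by blast
  show "matching E (M \<union> N)" "card (M \<union> N) = card M + card N"
    using matching_Un[OF m d] card_matching_Un[OF E m d] by auto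
qed

text \<open>Otherwise \<open>nu (del Hr {c}) = nu Hr\<close>. Exchanging \<open>pc\<close> and an edge \<open>zw\<close> for \<open>pz\<close> in a
  maximal matching then loses one edge, but nothing can be added.\<close>

lemma nu_del_z:
  assumes pq: "apex_pair p q" and c: "adj p c" "c \<notin> comp z" "c \<noteq> q" and w: "{z, w} \<in> Hz"
  shows "nu (del Hz {z}) = nu Hz" "nu Hr = Suc (nu (del Hr {c}))"
proof -
  note leg = nu_leg[OF pq c]
  note pqa = apex_pair_adj[OF pq]
  show 1: "nu (del Hz {z}) = nu Hz"
  proof (rule ccontr)
    assume "nu (del Hz {z}) \<noteq> nu Hz"
    then have lt: "nu Hz = Suc (nu (del Hz {z}))" "nu (del Hr {c}) = nu Hr"
      using leg(3) nu_del_le[OF edge_set_Hz nu_xy(1) leg(1)] nu_del_le[OF edge_set_Hr nu_xy(2) leg(2)]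
      by linarith+
    have zw: "{z, w} \<in> E" "z \<noteq> w" using w Hz_sub edge_neq[OF E] by auto
    have "matching Hz {{z, w}}" using w by (simp add: matching_def)
    then obtain MH where MH: "{z, w} \<in> MH" "maximal_matching Hz MH"
      using matching_extend[OF edge_set_Hz] by (metis insert_subset)
    note MH1 = maximal_matchingD[OF MH(2)]
    have cMH: "card MH = nu Hz" by (rule card_maximal_matching[OF edge_set_Hz nu_xy(1) MH(2)])
    obtain MP where MP: "maximal_matching (del Hr {c}) MP"
      using maximal_matching_ex[OF edge_set_del[OF edge_set_Hr]] by blast
    have MPc: "matching Hr MP" "c \<notin> \<Union>MP"
      using MP by (auto simp: maximal_matching_def matching_def del_def)
    have cMP: "card MP = nu Hr"
      using card_maximal_matching[OF edge_set_del[OF edge_set_Hr] leg(2) MP] lt(2) by simp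
    have MP': "maximal_matching Hr MP" by (rule maximal_matchingI_card[OF edge_set_Hr nu_xy(2) MPc(1) cMP])
    have UMH: "\<Union>MH \<subseteq> comp z" "\<Union>MH \<subseteq> \<Union>Hz" using matching_subset[OF MH1] by (auto simp: Hz_def)
    have UMP: "\<Union>MP \<inter> comp z = {}" "\<Union>MP \<subseteq> \<Union>Hr" using matching_subset[OF MPc(1)] by (auto simp: Hr_def)
    note out = apex_notin[OF pq]
    note B = matching_Hz_Hr[OF MH1 MPc(1)]
    have pcE: "{p, c} \<in> E" using c(1) by (simp add: adj_def)
    have d: "{p, c} \<inter> \<Union>(MH \<union> MP) = {}" using UMH UMP out MPc(2) c(2) by auto
    note L = matching_insert_all[OF E B(1) pcE d]
    have cL: "card (insert {p, c} (MH \<union> MP)) = nu E" using L(2) B(2) cMH cMP nu_xy(3) by simp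
    have maxL: "maximal_matching E (insert {p, c} (MH \<union> MP))"
      by (rule maximal_matchingI_card[OF E wed L(1) cL])
    note R = matching_remove[OF edge_set_Hz MH1 MH(1)]
    note B' = matching_Hz_Hr[OF R(1) MPc(1)]
    have pzE: "{p, z} \<in> E" using pqa(2) by (simp add: adj_def)
    have d: "{p, z} \<inter> \<Union>((MH - {{z, w}}) \<union> MP) = {}"
      using R(3) UMH UMP out comp_self[of z] by auto
    note L' = matching_insert_all[OF E B'(1) pzE d]
    have "card (insert {p, z} ((MH - {{z, w}}) \<union> MP)) < nu E"
      using L'(2) B'(2) R(2) cMH cMP nu_xy(3) by simp
    then obtain e where e: "e \<in> E" "e \<inter> \<Union>(insert {p, z} ((MH - {{z, w}}) \<union> MP)) = {}"
      by (rule matching_extendable[OF E wed L'(1)])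
    have e': "p \<notin> e" "z \<notin> e" "e \<inter> (\<Union>MH - {z, w}) = {}" "e \<inter> \<Union>MP = {}"
      using e(2) unfolding L'(3) Union_Un_distrib R(3) by blast+
    \<comment> \<open>If \<open>e\<close> contains \<open>q\<close>, maximality of the matching with
      \<open>pc\<close> makes its other end \<open>c\<close> or \<open>w\<close>: a triangle without
      \<open>z\<close>, respectively without \<open>p\<close>. In \<open>Hz\<close>, adding
      \<open>e\<close> gives a matching of size \<open>nu Hz\<close> that avoids \<open>z\<close>.
      In \<open>Hr\<close>, \<open>MP\<close> is already maximal.\<close>
    show False
    proof (cases "q \<in> e")
      case True
      obtain t where t: "e = {q, t}" by (rule edge_other[OF E e(1) True])
      have qt: "adj q t" using e(1) t by (simp add: adj_def)
      have qL: "q \<notin> \<Union>(insert {p, c} (MH \<union> MP))"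
        unfolding L(3) Union_Un_distrib using out(2,4) UMH(2) UMP(2) c(3) adj_neq[OF pqa(1)] by blast
      have "e \<inter> \<Union>(insert {p, c} (MH \<union> MP)) \<noteq> {}" by (rule maximal_matching_meets[OF maxL e(1)])
      then have "t \<in> \<Union>(insert {p, c} (MH \<union> MP))" using qL unfolding t by blast
      then have "t = c \<or> t = w" unfolding L(3) using e' t by auto
      then show False
      proof
        assume "t = c"
        then show False
          using no_triangle(3)[of q c p] qt adj_sym[OF c(1)] pqa c(2) comp_self[of z] adj_neq by auto
      next
        assume "t = w"
        moreover have "adj w z" using zw(1) by (simp add: adj_def insert_commute)
        moreover have "p \<noteq> w" using w out by auto
        ultimately show False
          using no_triangle_apex[OF pq qt, of z] pqa adj_neq[OF pqa(1)] adj_neq[OF pqa(2)] by auto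
      qed
    next
      case False
      then consider "e \<in> Hz" | "e \<in> Hr" using edge_split[OF e(1) pq e'(1)] by blast
      then show False
      proof cases
        case 1
        have d: "e \<inter> \<Union>(MH - {{z, w}}) = {}" using e'(3) R(3) by simp
        note N = matching_insert_all[OF edge_set_Hz R(1) 1 d]
        have "matching (del Hz {z}) (insert e (MH - {{z, w}}))"
          using N(1) R(3) e'(2) unfolding matching_def del_def by auto
        then show False
          using card_matching_le[OF edge_set_del[OF edge_set_Hz] leg(1)] N(2) R(2) cMH lt(1) by fastforce
      next
        case 2
        show False using maximal_matching_meets[OF MP' 2] e'(4) by simp
      qed
    qed
  qed
  then show "nu Hr = Suc (nu (del Hr {c}))" using leg(3) by simp
qed

text \<open>If \<open>q\<close> had only the neighbours \<open>p\<close> and \<open>z\<close>, then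
  \<open>pc\<close>, a maximal matching of \<open>Hz\<close> that covers \<open>z\<close> and one of
  \<open>Hr\<close> without \<open>c\<close> would block every edge, although together they have
  only \<open>nu E - 1\<close> edges.\<close>

lemma apex_degree:
  assumes pq: "apex_pair p q" and c: "adj p c" "c \<notin> comp z" "c \<noteq> q" and w: "{z, w} \<in> Hz"
  shows "\<exists>t. adj q t \<and> t \<noteq> p \<and> t \<noteq> z"
proof (rule ccontr)
  assume no: "\<nexists>t. adj q t \<and> t \<noteq> p \<and> t \<noteq> z"
  note leg = nu_leg[OF pq c]
  note nuz = nu_del_z[OF pq c w]
  note out = apex_notin[OF pq]
  have "matching Hz {{z, w}}" using w by (simp add: matching_def)
  then obtain MH where MH: "{z, w} \<in> MH" "maximal_matching Hz MH"
    using matching_extend[OF edge_set_Hz] by (metis insert_subset)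
  note MH1 = maximal_matchingD[OF MH(2)]
  have cMH: "card MH = nu Hz" by (rule card_maximal_matching[OF edge_set_Hz nu_xy(1) MH(2)])
  obtain MP where MP: "maximal_matching (del Hr {c}) MP"
    using maximal_matching_ex[OF edge_set_del[OF edge_set_Hr]] by blast
  have MPc: "matching Hr MP" "c \<notin> \<Union>MP"
    using MP by (auto simp: maximal_matching_def matching_def del_def)
  have cMP: "Suc (card MP) = nu Hr"
    using card_maximal_matching[OF edge_set_del[OF edge_set_Hr] leg(2) MP] nuz(2) by simp
  have UMH: "\<Union>MH \<subseteq> comp z" "\<Union>MH \<subseteq> \<Union>Hz" using matching_subset[OF MH1] by (auto simp: Hz_def)
  have UMP: "\<Union>MP \<subseteq> \<Union>Hr" using matching_subset[OF MPc(1)] by auto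
  note B = matching_Hz_Hr[OF MH1 MPc(1)]
  have pcE: "{p, c} \<in> E" using c(1) by (simp add: adj_def)
  have d: "{p, c} \<inter> \<Union>(MH \<union> MP) = {}" using UMH UMP out MPc(2) c(2) by auto
  note L = matching_insert_all[OF E B(1) pcE d]
  have "card (insert {p, c} (MH \<union> MP)) < nu E" using L(2) B(2) cMH cMP nu_xy(3) by simp
  then obtain e where e: "e \<in> E" "e \<inter> \<Union>(insert {p, c} (MH \<union> MP)) = {}"
    by (rule matching_extendable[OF E wed L(1)])
  have e': "p \<notin> e" "c \<notin> e" "e \<inter> \<Union>MH = {}" "e \<inter> \<Union>MP = {}" using e(2) by auto
  have "z \<notin> e" using e'(3) MH(1) by auto
  have "q \<notin> e"
  proof
    assume "q \<in> e"
    then obtain t where t: "e = {q, t}" by (rule edge_other[OF E e(1)])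
    then show False using no e(1) e'(1) \<open>z \<notin> e\<close> by (auto simp: adj_def)
  qed
  then consider "e \<in> Hz" | "e \<in> del Hr {c}"
    using edge_split[OF e(1) pq e'(1)] e'(2) by (auto simp: del_def)
  then show False
    using maximal_matching_meets[OF MH(2)] maximal_matching_meets[OF MP] e'(3,4) by metis
qed

text \<open>If \<open>c\<close> and \<open>d\<close> were in different components, deleting
  \<open>c\<close> would lower the value of the component of \<open>c\<close>, and deleting
  \<open>d\<close> that of the rest of \<open>Hr\<close>. Deleting the matching \<open>pc\<close>,
  \<open>qd\<close> would then lose both, so \<open>nu E\<close> would equal
  \<open>nu Hz + nu Hr\<close>, one less than by \<open>nu_xy\<close>.\<close>

lemma legs_same_component:
  assumes pq: "apex_pair p q" and c: "adj p c" "c \<notin> comp z" "c \<noteq> q"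
    and d: "adj q d" "d \<notin> comp z" "d \<noteq> p" and w: "{z, w} \<in> Hz"
  shows "d \<in> comp c"
proof (rule ccontr)
  assume dc: "d \<notin> comp c"
  define C where "C = {e \<in> Hr. e \<subseteq> comp c}"
  define R where "R = {e \<in> Hr. e \<inter> comp c = {}}"
  have Hr: "Hr = C \<union> R" using comp_edge[of _ c] by (auto simp: C_def R_def Hr_def)
  have CR: "\<Union>C \<inter> \<Union>R = {}" by (auto simp: C_def R_def)
  have cR: "c \<notin> \<Union>R" using comp_self[of c] by (auto simp: R_def)
  have dC: "d \<notin> \<Union>C" using dc by (auto simp: C_def)
  note pc = nu_leg(2)[OF pq c] nu_del_z(2)[OF pq c w]
  note qd = nu_leg(2)[OF apex_pair_sym[OF pq] d] nu_del_z(2)[OF apex_pair_sym[OF pq] d w]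
  have e1: "del Hr {c} = del C {c} \<union> R" using cR unfolding Hr by (auto simp: del_def)
  have e2: "del Hr {d} = C \<union> del R {d}" using dC unfolding Hr by (auto simp: del_def)
  have es: "edge_set (C \<union> R)" "edge_set (del C {c} \<union> R)" "edge_set (C \<union> del R {d})"
    using edge_set_Hr edge_set_del[OF edge_set_Hr] Hr e1 e2 by metis+
  have ds: "\<Union>(del C {c}) \<inter> \<Union>R = {}" "\<Union>C \<inter> \<Union>(del R {d}) = {}"
    "\<Union>(del C {c}) \<inter> \<Union>(del R {d}) = {}" using CR by (auto simp: del_def)
  have n1: "nu Hr = nu C + nu R" using nu_Un[OF es(1) _ CR] nu_xy(2) Hr by simp
  have n2: "nu (del Hr {c}) = nu (del C {c}) + nu R" using nu_Un[OF es(2) _ ds(1)] pc(1) e1 by simp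
  have n3: "nu (del Hr {d}) = nu C + nu (del R {d})" using nu_Un[OF es(3) _ ds(2)] qd(1) e2 by simp
  have cd: "c \<noteq> d" using dc comp_self by auto
  have ne: "{p, c} \<noteq> {q, d}" "{p, c} \<inter> {q, d} = {}"
    using c(3) d(3) cd apex_pair_adj[OF pq] adj_neq by auto
  have m: "matching E {{p, c}, {q, d}}" by (rule matching_two[OF c(1) d(1) ne(2)])
  have "del E {p, c, q, d} = del (del E {x, y}) {c, d}"
    using pq by (auto simp: del_def apex_pair_cases)
  also have "\<dots> = Hz \<union> del Hr {c, d}"
    using c(2) d(2) unfolding del_xy_split by (auto simp: del_def Hz_def)
  also have "del Hr {c, d} = del C {c} \<union> del R {d}"
    using cR dC unfolding Hr by (auto simp: del_def)
  finally have eq: "del E {p, c, q, d} = Hz \<union> (del C {c} \<union> del R {d})" .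
  have U: "wed (Hz \<union> (del C {c} \<union> del R {d}))" "edge_set (Hz \<union> (del C {c} \<union> del R {d}))"
    using wed_del[OF E wed m] edge_set_del[OF E, of "{p, c, q, d}"] eq by (simp_all add: insert_commute)
  have D: "\<Union>Hz \<inter> \<Union>(del C {c} \<union> del R {d}) = {}" using Hz_Hr_disjoint by (auto simp: del_def C_def R_def)
  have U2: "edge_set (del C {c} \<union> del R {d})" using edge_set_subset[OF U(2)] by blast
  have "nu E = 2 + nu (del E {p, c, q, d})"
    using nu_del[OF E wed m] ne(1) by (simp add: insert_commute)
  then have "nu E = 2 + nu Hz + nu (del C {c}) + nu (del R {d})"
    using eq nu_Un[OF U(2,1) D] nu_Un[OF U2 wed_Un2[OF U(2,1) D] ds(3)] by simp
  then show False using nu_xy(3) n1 n2 n3 pc(2) qd(2) by linarith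
qed

text \<open>Once \<open>q\<close> and \<open>z\<close> are deleted, \<open>p\<close> has no edges
  left. So deleting the one edge \<open>qz\<close> leaves \<open>Hz\<close> without \<open>z\<close>
  and all of \<open>Hr\<close>, to be compared with deleting the one edge \<open>xy\<close>.\<close>

lemma nu_del_z_degree_two:
  assumes pq: "apex_pair p q" and deg: "\<And>t. adj p t \<Longrightarrow> t = q \<or> t = z"
  shows "wed (del Hz {z})" "nu (del Hz {z}) = nu Hz"
proof -
  note pqa = apex_pair_adj[OF pq]
  have m: "matching E {{q, z}}" by (rule matching_single[OF pqa(3)])
  have "p \<notin> e" if e: "e \<in> del E {q, z}" for e
  proof
    assume p: "p \<in> e"
    have eE: "e \<in> E" using e by (simp add: del_def)
    obtain t where t: "e = {p, t}" by (rule edge_other[OF E eE p])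
    then have "t = q \<or> t = z" using deg eE by (simp add: adj_def)
    then show False using e t by (auto simp: del_def)
  qed
  then have "del E {q, z} = del (del E {x, y}) {z}"
    using pq by (fastforce simp: del_def apex_pair_cases)
  also have "\<dots> = del Hz {z} \<union> Hr"
    using z_notin_Hr unfolding del_xy_split by (auto simp: del_def)
  finally have eq: "del E {q, z} = del Hz {z} \<union> Hr" .
  have U: "wed (del Hz {z} \<union> Hr)" "edge_set (del Hz {z} \<union> Hr)"
    using wed_del[OF E wed m] edge_set_del[OF E, of "{q, z}"] eq by simp_all
  have d: "\<Union>(del Hz {z}) \<inter> \<Union>Hr = {}" using Hz_Hr_disjoint by (auto simp: del_def)
  show "wed (del Hz {z})" by (rule wed_Un1[OF U(2,1) d])
  show "nu (del Hz {z}) = nu Hz"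
    using nu_del[OF E wed m] nu_xy(3) eq nu_Un[OF U(2,1) d] by simp
qed

section \<open>The two parts of the component of \<open>z\<close>\<close>

definition odd_part :: "'a set" where
  "odd_part = {u. \<exists>n. odd n \<and> (z, u) \<in> rest_rel ^^ n}"

definition even_part :: "'a set" where
  "even_part = {u. \<exists>n. even n \<and> (z, u) \<in> rest_rel ^^ n}"

lemma parts_Un: "odd_part \<union> even_part = comp z"
  unfolding odd_part_def even_part_def comp_def rtrancl_is_UN_relpow by blast

lemma z_even_part: "z \<in> even_part"
  unfolding even_part_def by (auto intro!: exI[of _ 0])

text \<open>Walks of both parities from \<open>z\<close> to one vertex would join to an odd closed
  walk at \<open>z\<close>. Counting all walks, not just shortest ones, makes it immediate that
  edges alternate between the parts.\<close>

lemma parts_disjoint: "odd_part \<inter> even_part = {}"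
proof -
  have False if "(z, u) \<in> rest_rel ^^ n" "odd n" "(z, u) \<in> rest_rel ^^ m" "even m" for u n m
  proof -
    have "(u, z) \<in> rest_rel ^^ m" by (rule relpow_sym[OF sym_rest_rel that(3)])
    then have "(z, z) \<in> rest_rel ^^ (n + m)" using that(1) unfolding relpow_add by blast
    then show False using no_odd_closed_walk that(2,4) by fastforce
  qed
  then show ?thesis unfolding odd_part_def even_part_def by blast
qed

lemma parts_step:
  assumes "(u, v) \<in> rest_rel"
  shows "u \<in> odd_part \<Longrightarrow> v \<in> even_part" "u \<in> even_part \<Longrightarrow> v \<in> odd_part"
proof -
  have "(z, v) \<in> rest_rel ^^ Suc n" if "(z, u) \<in> rest_rel ^^ n" for n
    using that assms by (rule relpow_Suc_I)
  then show "u \<in> odd_part \<Longrightarrow> v \<in> even_part" "u \<in> even_part \<Longrightarrow> v \<in> odd_part"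
    unfolding odd_part_def even_part_def mem_Collect_eq by (metis even_Suc)+
qed

lemma parts_edge:
  assumes e: "e \<in> Hz"
  shows "\<exists>a\<in>odd_part. \<exists>b\<in>even_part. e = {a, b}"
proof -
  obtain a b where ab: "e = {a, b}" "a \<noteq> b" by (rule edge_cases[OF edge_set_Hz e])
  have r: "(a, b) \<in> rest_rel" "a \<in> comp z" using e ab by (auto simp: Hz_def rest_rel_def)
  then have "a \<in> odd_part \<or> a \<in> even_part" using parts_Un by blast
  then show ?thesis using parts_step[OF r(1)] ab(1) by (auto simp: insert_commute)
qed

text \<open>A maximal matching of \<open>Hz\<close> without \<open>z\<close> has
  \<open>nu Hz\<close> edges, so it is also maximal in \<open>Hz\<close>. It misses \<open>z\<close>
  and therefore saturates the part that does not contain \<open>z\<close>.\<close>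

lemma parts_card:
  assumes fin: "finite (comp z)" and w: "wed (del Hz {z})" and nu: "nu (del Hz {z}) = nu Hz"
  shows "card odd_part < card even_part"
proof -
  obtain M where M: "maximal_matching (del Hz {z}) M"
    using maximal_matching_ex[OF edge_set_del[OF edge_set_Hz]] by blast
  have M1: "matching Hz M" "z \<notin> \<Union>M"
    using M by (auto simp: maximal_matching_def matching_def del_def)
  have "card M = nu Hz" using card_maximal_matching[OF edge_set_del[OF edge_set_Hz] w M] nu by simp
  then have M2: "maximal_matching Hz M" by (rule maximal_matchingI_card[OF edge_set_Hz nu_xy(1) M1(1)])
  have conn: "odd_part \<subseteq> T" if T: "z \<in> T" "\<And>u v. u \<in> T \<Longrightarrow> {u, v} \<in> Hz \<Longrightarrow> v \<in> T" for T
  proof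
    fix u assume "u \<in> odd_part"
    then have "(z, u) \<in> rest_rel\<^sup>*" using parts_Un by (auto simp: comp_def)
    then have "u \<in> T \<and> u \<in> comp z"
    proof (induction rule: rtrancl_induct)
      case base
      then show ?case using T(1) comp_self by blast
    next
      case (step a b)
      then have "b \<in> comp z" using comp_closed by blast
      then have "{a, b} \<in> Hz" using step by (auto simp: Hz_def rest_rel_def)
      then show ?case using T(2) step.IH \<open>b \<in> comp z\<close> by blast
    qed
    then show "u \<in> T" ..
  qed
  have sat: "odd_part \<subseteq> \<Union>M"
    by (rule maximal_matching_missing_saturates[OF edge_set_Hz nu_xy(1) parts_edge parts_disjoint
          conn M2 z_even_part M1(2)])
  have B: "finite even_part" by (rule finite_subset[OF _ fin]) (use parts_Un in blast)
  show ?thesis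
    by (rule card_less_saturated[OF M1(1) parts_edge parts_disjoint sat z_even_part M1(2) B])
qed

text \<open>Otherwise the component would be closed under adjacency in the whole graph, and
  connectedness would put \<open>x\<close> into it.\<close>

lemma component_touches_apex:
  assumes u: "u \<in> \<Union>E" "u \<noteq> x" "u \<noteq> y"
  obtains p t where "p = x \<or> p = y" "t \<in> comp u" "adj p t"
proof (rule ccontr)
  assume no: "\<not> thesis"
  have "\<Union>E \<subseteq> comp u"
  proof (rule connected)
    show "comp u \<inter> \<Union>E \<noteq> {}" using u comp_self by blast
    fix a b assume ab: "a \<in> comp u" "{a, b} \<in> E"
    have "a \<noteq> x \<and> a \<noteq> y"
    proof -
      have "(u, a) \<in> rest_rel\<^sup>*" using ab(1) by (simp add: comp_def)
      then show ?thesis using u(2,3) by (cases rule: rtrancl.cases) (auto dest: rest_relD)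
    qed
    moreover have "b \<noteq> x \<and> b \<noteq> y" using no that[of b a] ab adj_sym[of a b] by (auto simp: adj_def)
    ultimately show "b \<in> comp u" using comp_closed[OF ab(1)] rest_relI[of a b] ab(2) by (simp add: adj_def)
  qed
  then have "x \<in> comp u" using xy by blast
  then have "(u, x) \<in> rest_rel\<^sup>*" by (simp add: comp_def)
  then show False using u(2) by (cases rule: rtrancl.cases) (auto dest: rest_relD)
qed

end

section \<open>Detachability\<close>

lemma unique_triangle_graph:
  assumes sg: "simple_graph G" and conn: "connected_graph G" and w: "well_edge_dominated G"
    and tri: "triangles G = {complete_on {x, y, z}}"
  shows "unique_triangle (edges G) x y z"
proof -
  have "edges G \<subseteq> Pow (verts G)" "finite (verts G)" using sg by (auto simp: simple_graph_def)
  then have E: "edge_set (edges G)"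
    using sg finite_subset[of "edges G" "Pow (verts G)"] by (simp add: simple_graph_def edge_set_def)
  have "complete_on {x, y, z} \<in> triangles G" using tri by simp
  then have c3: "card {x, y, z} = 3" and sub: "edges (complete_on {x, y, z}) \<subseteq> edges G"
    by (auto simp: triangles_def subgraph_def is_complete_def complete_on_def)
  have "x \<noteq> y" "x \<noteq> z" "y \<noteq> z" using c3 by (auto simp: card_insert_if split: if_splits)
  then have e: "{x, y} \<in> edges G" "{x, z} \<in> edges G" "{y, z} \<in> edges G"
    using sub by (simp_all add: complete_on_def subset_iff)
  show ?thesis
  proof
    show "edge_set (edges G)" by (rule E)
    show "wed (edges G)" using w by (simp add: well_edge_dominated_iff_wed)
    show "{x, y} \<in> edges G" "{x, z} \<in> edges G" "{y, z} \<in> edges G" using e by auto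
  next
    fix a b c assume abc: "{a, b} \<in> edges G" "{b, c} \<in> edges G" "{a, c} \<in> edges G"
    have ne: "a \<noteq> b" "b \<noteq> c" "a \<noteq> c" using abc edge_neq[OF E] by auto
    have "e \<in> edges G" if "e \<subseteq> {a, b, c}" "card e = 2" for e
    proof -
      obtain s t where "e = {s, t}" "s \<noteq> t" using \<open>card e = 2\<close> by (meson card_2_iff)
      then show ?thesis using that(1) abc by (auto simp: insert_commute)
    qed
    moreover have "{a, b, c} \<subseteq> verts G" using abc sg by (auto simp: simple_graph_def)
    ultimately have "complete_on {a, b, c} \<in> triangles G"
      using ne by (auto simp: triangles_def subgraph_def is_complete_def complete_on_def simple_graph_def)
    then have "verts (complete_on {a, b, c}) = verts (complete_on {x, y, z})" using tri by simp
    then show "{a, b, c} = {x, y, z}" by (simp add: complete_on_def)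
  next
    fix A assume A: "A \<inter> \<Union>(edges G) \<noteq> {}" "\<And>a b. a \<in> A \<Longrightarrow> {a, b} \<in> edges G \<Longrightarrow> b \<in> A"
    obtain a where a: "a \<in> A" "a \<in> \<Union>(edges G)" using A(1) by blast
    have V: "\<Union>(edges G) \<subseteq> verts G" using sg by (auto simp: simple_graph_def)
    show "\<Union>(edges G) \<subseteq> A"
    proof
      fix v assume "v \<in> \<Union>(edges G)"
      then have "(a, v) \<in> (adj_rel G)\<^sup>*" using conn a(2) V unfolding connected_graph_def by blast
      then show "v \<in> A"
        by (induction rule: rtrancl_induct) (use a(1) A(2) in \<open>auto simp: adj_rel_def\<close>)
    qed
  qed
qed

lemma verts_in_edges:
  assumes "connected_graph G" "x \<in> verts G" "v \<in> verts G" "v \<noteq> x"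
  shows "v \<in> \<Union>(edges G)"
proof -
  have "(v, x) \<in> (adj_rel G)\<^sup>*" using assms by (auto simp: connected_graph_def)
  then show ?thesis using assms(4) by (cases rule: converse_rtranclE) (auto simp: adj_rel_def)
qed

context unique_triangle
begin

definition Gz :: "'a ugraph" where
  "Gz = \<lparr>verts = comp z, edges = Hz\<rparr>"

lemma connected_Gz: "connected_graph Gz"
proof -
  have step: "(a, b) \<in> adj_rel Gz" if "a \<in> comp z" "(a, b) \<in> rest_rel" for a b
    using that comp_closed[OF that] by (auto simp: adj_rel_def Gz_def Hz_def rest_rel_def)
  have path: "(z, u) \<in> (adj_rel Gz)\<^sup>*" if "u \<in> comp z" for u
  proof -
    have "(z, u) \<in> rest_rel\<^sup>*" using that by (simp add: comp_def)
    then have "(z, u) \<in> (adj_rel Gz)\<^sup>* \<and> u \<in> comp z"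
    proof (induction rule: rtrancl_induct)
      case base
      then show ?case using comp_self by simp
    next
      case (step a b)
      then show ?case using \<open>\<And>a b. a \<in> comp z \<Longrightarrow> (a, b) \<in> rest_rel \<Longrightarrow> (a, b) \<in> adj_rel Gz\<close> comp_closed
        by (meson rtrancl.rtrancl_into_rtrancl)
    qed
    then show ?thesis ..
  qed
  have "sym (adj_rel Gz)" by (auto simp: adj_rel_def sym_def insert_commute)
  then have "(u, z) \<in> (adj_rel Gz)\<^sup>*" if "u \<in> comp z" for u
    using path[OF that] sym_rtrancl by (metis symD)
  then show ?thesis
    using path comp_self[of z] by (auto simp: connected_graph_def Gz_def intro: rtrancl_trans)
qed

lemma simple_Gz: "finite (comp z) \<Longrightarrow> simple_graph Gz"
  using edge_set_Hz by (auto simp: simple_graph_def Gz_def edge_set_def Hz_def)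

lemma bipartition_Gz: "bipartition Gz odd_part even_part"
  unfolding bipartition_def using parts_Un parts_disjoint parts_edge by (simp add: Gz_def)

lemma detachable_Gz:
  assumes fin: "finite (comp z)" and w: "wed (del Hz {z})" and nu: "nu (del Hz {z}) = nu Hz"
  shows "detachable Gz z"
proof -
  have "well_edge_dominated Gz" using nu_xy(1) by (simp add: well_edge_dominated_iff_wed Gz_def)
  moreover have "well_edge_dominated (delete_verts Gz {z})"
    using w by (simp add: well_edge_dominated_iff_wed Gz_def delete_verts_def del_def)
  ultimately show ?thesis
    using simple_Gz[OF fin] connected_Gz bipartition_Gz parts_card[OF assms] z_even_part
    unfolding detachable_def by blast
qed

lemma Hz_neighbour:
  assumes "nontrivial Gz"
  obtains w where "{z, w} \<in> Hz"
proof -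
  have "2 \<le> card (comp z)" using assms by (simp add: nontrivial_def Gz_def)
  then have "comp z \<noteq> {z}" by auto
  then obtain u where u: "u \<in> comp z" "u \<noteq> z" using comp_self[of z] by auto
  then have "(z, u) \<in> rest_rel\<^sup>*" by (simp add: comp_def)
  then obtain w where w: "(z, w) \<in> rest_rel" using u(2) by (cases rule: converse_rtranclE) auto
  then have "w \<in> comp z" using comp_closed comp_self by blast
  then show thesis using that w comp_self[of z] by (auto simp: Hz_def rest_rel_def)
qed

lemma degree_two_neighbours:
  assumes pq: "apex_pair p q" and d: "card {e \<in> E. p \<in> e} = 2" and t: "adj p t"
  shows "t = q \<or> t = z"
proof -
  note pqa = apex_pair_adj[OF pq]
  have ne: "{p, q} \<noteq> {p, z}" using adj_neq[OF pqa(3)] by (auto simp: doubleton_eq_iff)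
  have "finite {e \<in> E. p \<in> e}" using E by (simp add: edge_set_def)
  moreover have "{{p, q}, {p, z}} \<subseteq> {e \<in> E. p \<in> e}" using pqa by (auto simp: adj_def)
  ultimately have "{{p, q}, {p, z}} = {e \<in> E. p \<in> e}"
    using d ne by (intro card_subset_eq) auto
  then have "{p, t} \<in> {{p, q}, {p, z}}" using t by (auto simp: adj_def)
  then show ?thesis by (auto simp: doubleton_eq_iff)
qed

lemma degree_three:
  assumes pq: "apex_pair p q" and t: "adj p t" "t \<noteq> q" "t \<noteq> z"
  shows "3 \<le> card {e \<in> E. p \<in> e}"
proof -
  have "card {e \<in> E. p \<in> e} \<noteq> 2" using degree_two_neighbours[OF pq _ t(1)] t(2,3) by blast
  moreover have "2 \<le> card {e \<in> E. p \<in> e}"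
  proof -
    note pqa = apex_pair_adj[OF pq]
    have "card {{p, q}, {p, z}} = 2" using adj_neq[OF pqa(3)] by (auto simp: doubleton_eq_iff)
    moreover have "{{p, q}, {p, z}} \<subseteq> {e \<in> E. p \<in> e}" using pqa by (auto simp: adj_def)
    moreover have "finite {e \<in> E. p \<in> e}" using E by (simp add: edge_set_def)
    ultimately show ?thesis
      using card_mono[of "{e \<in> E. p \<in> e}" "{{p, q}, {p, z}}"] by linarith
  qed
  ultimately show ?thesis by linarith
qed

end

theorem theorem6:
  fixes G :: "'a ugraph" and x y z :: 'a
  defines "G' \<equiv> delete_nbhd G {{x, y}}"
  defines "Gz \<equiv> component_of G' z"
  assumes "simple_graph G"
    and "connected_graph G"
    and "well_edge_dominated G"
    and "\<not> is_complete 3 G"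
    and "triangles G = {complete_on {x, y, z}}"
  shows "bipartite Gz \<and>
    (nontrivial Gz \<longrightarrow>
      ((\<forall>e\<in>edges G. x \<in> e \<and> e \<noteq> {x, y} \<and> e \<noteq> {x, z} \<longrightarrow> e \<inter> verts Gz \<noteq> {}) \<and>
       (\<forall>e\<in>edges G. y \<in> e \<and> e \<noteq> {x, y} \<and> e \<noteq> {y, z} \<longrightarrow> e \<inter> verts Gz \<noteq> {}) \<and>
       (degree G x = 2 \<or> degree G y = 2 \<longrightarrow> detachable Gz z))
      \<or>
      (\<exists>u v. {u, v} = {x, y} \<and>
        (\<forall>C\<in>components G'. C \<noteq> Gz \<longrightarrow> (\<exists>w\<in>verts C. {u, w} \<in> edges G)) \<and>
        degree G v \<ge> 3 \<and>
        detachable Gz z))"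
proof -
  interpret T: unique_triangle "edges G" x y z
    by (rule unique_triangle_graph[OF assms(3-5,7)])
  have V: "\<Union>(edges G) \<subseteq> verts G" and finV: "finite (verts G)"
    using assms(3) by (auto simp: simple_graph_def)
  have G': "verts G' = verts G - {x, y}" "edges G' = del (edges G) {x, y}"
    by (simp_all add: G'_def delete_nbhd_def delete_verts_def del_def)
  have adjG': "adj_rel G' = T.rest_rel" by (simp add: adj_rel_def T.rest_rel_def G')
  have compV: "T.comp v \<subseteq> verts G'" if "v \<in> verts G'" for v
  proof
    fix u assume "u \<in> T.comp v"
    then have "(v, u) \<in> T.rest_rel\<^sup>*" by (simp add: T.comp_def)
    then show "u \<in> verts G'"
    proof (cases rule: rtrancl.cases)
      case (rtrancl_into_rtrancl b)
      then show ?thesis using T.rest_relD[of b u] V G'(1) by (auto simp: T.adj_def)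
    qed (use that in simp)
  qed
  have component: "component_of G' v = \<lparr>verts = T.comp v, edges = {e \<in> del (edges G) {x, y}. e \<subseteq> T.comp v}\<rparr>"
    if "v \<in> verts G'" for v
  proof -
    have "{u \<in> verts G'. (v, u) \<in> (adj_rel G')\<^sup>*} = T.comp v"
      using compV[OF that] by (auto simp: T.comp_def adjG')
    then show ?thesis using compV[OF that] by (auto simp: component_of_def induced_def G'(2))
  qed
  have xyz: "x \<in> verts G" "x \<noteq> z" "y \<noteq> z" "x \<noteq> y"
    using T.xy V edge_neq[OF T.E T.xz] edge_neq[OF T.E T.yz] edge_neq[OF T.E T.xy] by auto
  have zG: "z \<in> verts G'" using T.xz V xyz G'(1) by auto
  have Gz: "Gz = T.Gz" using component[OF zG] by (simp add: Gz_def T.Gz_def T.Hz_def)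
  have fin: "finite (T.comp z)" using compV[OF zG] finV G'(1) by (auto intro: finite_subset)
  have vGz: "verts T.Gz = T.comp z" by (simp add: T.Gz_def)
  have pair: "T.apex_pair x y" "T.apex_pair y x" by (auto simp: T.apex_pair_def)
  have touch: "\<exists>w\<in>T.comp v. T.adj x w \<or> T.adj y w" if v: "v \<in> verts G'" for v
    using T.component_touches_apex[of v] verts_in_edges[OF assms(4) xyz(1), of v] v G'(1) by auto
  \<comment> \<open>If every neighbour of \<open>x\<close> or \<open>y\<close>, apart from these two
    themselves, lies in the component of \<open>z\<close>, then (a) holds; otherwise (b).\<close>
  have main: "((\<forall>e\<in>edges G. x \<in> e \<and> e \<noteq> {x, y} \<and> e \<noteq> {x, z} \<longrightarrow> e \<inter> verts T.Gz \<noteq> {}) \<and>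
       (\<forall>e\<in>edges G. y \<in> e \<and> e \<noteq> {x, y} \<and> e \<noteq> {y, z} \<longrightarrow> e \<inter> verts T.Gz \<noteq> {}) \<and>
       (degree G x = 2 \<or> degree G y = 2 \<longrightarrow> detachable T.Gz z))
      \<or>
      (\<exists>u v. {u, v} = {x, y} \<and>
        (\<forall>C\<in>components G'. C \<noteq> T.Gz \<longrightarrow> (\<exists>w\<in>verts C. {u, w} \<in> edges G)) \<and>
        degree G v \<ge> 3 \<and>
        detachable T.Gz z)" (is "?a \<or> ?b") if nt: "nontrivial T.Gz"
  proof (cases "\<exists>p q c. T.apex_pair p q \<and> T.adj p c \<and> c \<noteq> q \<and> c \<notin> T.comp z")
    case False
    have inc: "e \<inter> T.comp z \<noteq> {}"
      if e: "T.apex_pair p q" "e \<in> edges G" "p \<in> e" "e \<noteq> {p, q}" for p q e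
    proof -
      obtain c where c: "e = {p, c}" by (rule edge_other[OF T.E e(2,3)])
      then have "T.adj p c" "c \<noteq> q" using e(2,4) by (auto simp: T.adj_def)
      then have "c \<in> T.comp z" using False e(1) by blast
      then show ?thesis using c by blast
    qed
    have "detachable T.Gz z" if "degree G p = 2" "T.apex_pair p q" for p q
      using T.detachable_Gz[OF fin] T.nu_del_z_degree_two[OF that(2)]
        T.degree_two_neighbours[OF that(2)] that(1) unfolding degree_def by blast
    then have "degree G x = 2 \<or> degree G y = 2 \<longrightarrow> detachable T.Gz z" using pair by blast
    then have ?a using inc[OF pair(1)] inc[OF pair(2)] unfolding vGz by (simp add: insert_commute)
    then show ?thesis ..
  next
    case True
    then obtain p q c where pq: "T.apex_pair p q" and c: "T.adj p c" "c \<notin> T.comp z" "c \<noteq> q" by blast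
    obtain w where w: "{z, w} \<in> T.Hz" by (rule T.Hz_neighbour[OF nt])
    have det: "detachable T.Gz z"
      by (rule T.detachable_Gz[OF fin T.nu_leg(1)[OF pq c] T.nu_del_z(1)[OF pq c w]])
    have "c \<noteq> z" using c(2) T.comp_self by auto
    then have "degree G p \<ge> 3" using T.degree_three[OF pq c(1,3)] by (simp add: degree_def)
    moreover have "degree G q \<ge> 3"
      using T.apex_degree[OF pq c w] T.degree_three[OF T.apex_pair_sym[OF pq]] unfolding degree_def by blast
    ultimately have deg: "degree G x \<ge> 3" "degree G y \<ge> 3" using pq by (auto simp: T.apex_pair_cases)
    let ?t = "\<lambda>u. \<forall>C\<in>components G'. C \<noteq> T.Gz \<longrightarrow> (\<exists>w\<in>verts C. {u, w} \<in> edges G)"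
    \<comment> \<open>Otherwise some component other than that of \<open>z\<close> is not reached
      from \<open>x\<close>, hence reached from \<open>y\<close> at \<open>d\<close>, and one is not
      reached from \<open>y\<close>, hence reached from \<open>x\<close> at \<open>b\<close>. Then
      \<open>d\<close> lies in the component of \<open>b\<close>, against the choice of the latter.
      Both degrees are at least three, so either of \<open>x\<close>, \<open>y\<close> can take the
      role of \<open>u\<close>.\<close>
    have "?t x \<or> ?t y"
    proof (rule ccontr)
      assume none: "\<not> (?t x \<or> ?t y)"
      have ex: "\<exists>u. u \<in> verts G' \<and> component_of G' u \<noteq> T.Gz \<and> (\<forall>w\<in>T.comp u. \<not> T.adj a w)"
        if nt: "\<not> ?t a" for a
      proof -
        obtain C where C: "C \<in> components G'" "C \<noteq> T.Gz" "\<forall>w\<in>verts C. {a, w} \<notin> edges G"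
          using nt by blast
        then obtain u where u: "u \<in> verts G'" "C = component_of G' u" by (auto simp: components_def)
        then have "verts C = T.comp u" using component[OF u(1)] by simp
        then show ?thesis using u C(2,3) by (auto simp: T.adj_def)
      qed
      obtain u where u: "u \<in> verts G'" "component_of G' u \<noteq> T.Gz" "\<And>w. w \<in> T.comp u \<Longrightarrow> \<not> T.adj x w"
        using ex[of x] none by auto
      obtain v where v: "v \<in> verts G'" "component_of G' v \<noteq> T.Gz" "\<And>w. w \<in> T.comp v \<Longrightarrow> \<not> T.adj y w"
        using ex[of y] none by auto
      obtain d where d: "d \<in> T.comp u" "T.adj y d" using touch[OF u(1)] u(3) by blast
      obtain b where b: "b \<in> T.comp v" "T.adj x b" using touch[OF v(1)] v(3) by blast
      have far: "a \<notin> T.comp z" if "s \<in> verts G'" "component_of G' s \<noteq> T.Gz" "a \<in> T.comp s" for a s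
      proof
        assume "a \<in> T.comp z"
        then have "T.comp s = T.comp z" using T.comp_eq that(3) by metis
        then have "component_of G' s = component_of G' z"
          using component[OF that(1)] component[OF zG] by simp
        then show False using that(2) Gz by (simp add: Gz_def)
      qed
      have ne: "b \<noteq> y" "d \<noteq> x" using b(1) d(1) compV u(1) v(1) G'(1) by auto
      have "d \<in> T.comp b"
        by (rule T.legs_same_component[OF pair(1) b(2) far[OF v(1,2) b(1)] ne(1) d(2) far[OF u(1,2) d(1)] ne(2) w])
      then have "d \<in> T.comp v" using T.comp_eq[OF b(1)] by simp
      then show False using v(3) d(2) by blast
    qed
    then have ?b
    proof
      assume "?t x"
      then show ?b using deg(2) det by blast
    next
      assume "?t y"
      then have "{y, x} = {x, y} \<and> ?t y \<and> degree G x \<ge> 3 \<and> detachable T.Gz z" using deg(1) det by blast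
      then show ?b by blast
    qed
    then show ?thesis ..
  qed
  show ?thesis
    unfolding Gz using main T.bipartition_Gz by (auto simp: bipartite_def)
qed

end
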